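(* Let $\Omega\subset\mathbb R^n$ be open, let $x_0\in\Omega$ and $0<r_1<r_2<d(x_0,\partial\Omega)$. Write $B_j=B(x_0,r_j)$, $j=1,2$. Let $T>0$ and $0<\epsilon<T$. Write $L=\partial_t-\Delta$. Then there are $C>0$ and $\kappa\in(0,1)$ such that for all $u\in C^2(\mathbb R\times\Omega)$ $$\|u\|_{L^2(\epsilon,T-\epsilon;H^1(B_2))}\le C\left(\|u\|_{L^2(0,T;H^1(B_1))}+\|Lu\|_{L^2((0,T)\times\Omega)}\right)^\kappa\|u\|_{L^2(0,T;H^1(\Omega))}^{1-\kappa}.$$
   Context: $d$ is the Euclidean distance and $B(x,r)=\{y\in\Omega: d(y,x)<r\}$. The Laplacian $\Delta$ acts in the spatial variable only. *)

theory Defs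
  imports "HOL-Analysis.Analysis"
begin

(* The first and second Frechet derivatives exist on S and the second one is continuous.
   Intended for open S, where at x does not look outside S. *)
definition C2_on :: "'a::real_normed_vector set \<Rightarrow> ('a \<Rightarrow> 'b::real_normed_vector) \<Rightarrow> bool" where
  "C2_on S f \<longleftrightarrow>
     (\<exists>(f' :: 'a \<Rightarrow> 'a \<Rightarrow>\<^sub>L 'b) (f'' :: 'a \<Rightarrow> 'a \<Rightarrow>\<^sub>L ('a \<Rightarrow>\<^sub>L 'b)).
        (\<forall>x\<in>S. (f has_derivative blinfun_apply (f' x)) (at x)) \<and>
        (\<forall>x\<in>S. (f' has_derivative blinfun_apply (f'' x)) (at x)) \<and>
        continuous_on S f'')"

definition partial :: "'n::finite \<Rightarrow> (real^'n \<Rightarrow> real) \<Rightarrow> real^'n \<Rightarrow> real" where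
  "partial i f x = frechet_derivative f (at x) (axis i 1)"

definition gradient :: "(real^'n::finite \<Rightarrow> real) \<Rightarrow> real^'n \<Rightarrow> real^'n" where
  "gradient f x = (\<chi> i. partial i f x)"

definition laplacian :: "(real^'n::finite \<Rightarrow> real) \<Rightarrow> real^'n \<Rightarrow> real" where
  "laplacian f x = (\<Sum>i\<in>UNIV. partial i (partial i f) x)"

definition heat_op :: "(real \<times> (real^'n::finite) \<Rightarrow> real) \<Rightarrow> real \<times> (real^'n) \<Rightarrow> real" where
  "heat_op u p =
     deriv (\<lambda>s. u (s, snd p)) (fst p) - laplacian (\<lambda>y. u (fst p, y)) (snd p)"

(* Powers of extended nonnegative reals; only used with exponents a > 0. *)
definition ennpowr :: "ennreal \<Rightarrow> real \<Rightarrow> ennreal" where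
  "ennpowr x a = (if x = \<infinity> then \<infinity> else ennreal (enn2real x powr a))"

(* All norms take values in [0, \<infinity>], being \<infinity> when the function is not in the space. *)
definition L2_norm :: "'a::euclidean_space set \<Rightarrow> ('a \<Rightarrow> 'b::real_normed_vector) \<Rightarrow> ennreal" where
  "L2_norm S f = ennpowr (\<integral>\<^sup>+x\<in>S. ennreal ((norm (f x))\<^sup>2) \<partial>lborel) (1/2)"

(* Only used for functions that are C2 on an open S, so that the classical gradient
   is also the distributional one. *)
definition H1_norm :: "(real^'n::finite) set \<Rightarrow> (real^'n \<Rightarrow> real) \<Rightarrow> ennreal" where
  "H1_norm S f = ennpowr ((L2_norm S f)\<^sup>2 + (L2_norm S (gradient f))\<^sup>2) (1/2)"

(* The norm of L^2(a, b; H^1(S)). *)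
definition L2H1_norm ::
  "real \<Rightarrow> real \<Rightarrow> (real^'n::finite) set \<Rightarrow> (real \<times> (real^'n) \<Rightarrow> real) \<Rightarrow> ennreal" where
  "L2H1_norm a b S u =
     ennpowr (\<integral>\<^sup>+t\<in>{a<..<b}. (H1_norm S (\<lambda>x. u (t, x)))\<^sup>2 \<partial>lborel) (1/2)"

definition ball_in :: "'a::metric_space set \<Rightarrow> 'a \<Rightarrow> real \<Rightarrow> 'a set" where
  "ball_in \<Omega> x r = {y \<in> \<Omega>. dist y x < r}"

(* Unlike infdist, this is \<infinity> for A = {}; needed because the frontier of \<Omega> = UNIV is empty. *)
definition edist_to :: "'a::metric_space \<Rightarrow> 'a set \<Rightarrow> ereal" where
  "edist_to x A = (INF y\<in>A. ereal (dist x y))"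

end

theory Submission
  imports Defs
begin

text \<open>The estimate follows from a Carleman inequality for L with the weight
  \<phi>(t, x) = exp(-\<mu> |x - x0|^2) - g(t), where g \<ge> 0 vanishes on [\<epsilon>, T - \<epsilon>] and equals 1 near 0 and T.
  With v = exp(\<tau> \<phi>) w, the conjugated operator F = exp(\<tau> \<phi>) L w is split as F = M + R with a first order
  part M and R = -\<Delta> v - k v, so that F^2 \<ge> 2 M R. Integrating 2 M R by parts leaves a quadratic form in v and
  its gradient which is coercive for large \<tau> once \<mu> |x - x0|^2 \<ge> 2. Applied to w = \<chi> u with a cutoff \<chi>
  that removes the axis, the lateral boundary and both ends of the time interval, this bounds the left hand side
  squared by C (exp(p \<tau>) (small cylinder + Lu) + exp(-q \<tau>) (large cylinder)) for all large \<tau>, and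
  optimising \<tau> gives the Hoelder type interpolation. All norms may be taken over a ball with compact closure
  in \<Omega>, where they are finite.\<close>

section \<open>Functions of class C2\<close>

definition C2jet :: "'a::euclidean_space set \<Rightarrow> ('a \<Rightarrow> real) \<Rightarrow> ('a \<Rightarrow> 'a \<Rightarrow> real) \<Rightarrow> ('a \<Rightarrow> 'a \<Rightarrow> 'a \<Rightarrow> real) \<Rightarrow> bool"
  where "C2jet U v V W \<longleftrightarrow>
    (\<forall>x\<in>U. (v has_derivative (\<lambda>e. V e x)) (at x)) \<and>
    (\<forall>x\<in>U. \<forall>e. (V e has_derivative (\<lambda>f. W e f x)) (at x)) \<and>
    (\<forall>e f. continuous_on U (W e f))"

lemma C2jetI:
  assumes "\<And>x. x \<in> U \<Longrightarrow> (v has_derivative (\<lambda>e. V e x)) (at x)"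
    and "\<And>x e. x \<in> U \<Longrightarrow> (V e has_derivative (\<lambda>f. W e f x)) (at x)"
    and "\<And>e f. continuous_on U (W e f)"
  shows "C2jet U v V W"
  using assms by (auto simp: C2jet_def)

lemma C2jetD:
  assumes "C2jet U v V W"
  shows "x \<in> U \<Longrightarrow> (v has_derivative (\<lambda>e. V e x)) (at x)"
    and "x \<in> U \<Longrightarrow> (V e has_derivative (\<lambda>f. W e f x)) (at x)"
    and "continuous_on U (W e f)"
    and "continuous_on U (V e)"
    and "continuous_on U v"
proof -
  show 1: "x \<in> U \<Longrightarrow> (v has_derivative (\<lambda>e. V e x)) (at x)" for x
    using assms by (auto simp: C2jet_def)
  show 2: "x \<in> U \<Longrightarrow> (V e has_derivative (\<lambda>f. W e f x)) (at x)" for x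
    using assms by (auto simp: C2jet_def)
  show "continuous_on U (W e f)" using assms by (auto simp: C2jet_def)
  show "continuous_on U (V e)"
    using 2 by (meson continuous_at_imp_continuous_on has_derivative_continuous)
  show "continuous_on U v"
    using 1 by (meson continuous_at_imp_continuous_on has_derivative_continuous)
qed

lemma C2jet_subset: "C2jet U v V W \<Longrightarrow> S \<subseteq> U \<Longrightarrow> C2jet S v V W"
  unfolding C2jet_def by (meson continuous_on_subset subsetD)

lemma C2jet_union:
  assumes "C2jet S v V W" "C2jet U v V W" "open S" "open U"
  shows "C2jet (S \<union> U) v V W"
  using assms unfolding C2jet_def by (auto intro: continuous_on_open_Un)

lemma C2jet_locally_const:
  assumes "C2jet U v V W" "open S" "S \<subseteq> U" "\<And>x. x \<in> S \<Longrightarrow> v x = c" "x \<in> S"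
  shows "V e x = 0" and "W e f x = 0"
proof -
  have V: "V e y = 0" if "y \<in> S" for e y
  proof -
    have "(v has_derivative (\<lambda>e. 0)) (at y)"
      using has_derivative_transform_within_open[OF has_derivative_const, of S y c v] assms that by auto
    moreover have "(v has_derivative (\<lambda>e. V e y)) (at y)"
      using assms that C2jetD(1) by blast
    ultimately have "(\<lambda>e. V e y) = (\<lambda>e. 0)"
      using has_derivative_unique by blast
    thus ?thesis by metis
  qed
  show "V e x = 0" using V assms by blast
  have "(V e has_derivative (\<lambda>e. 0)) (at x)"
    using has_derivative_transform_within_open[OF has_derivative_const, of S x 0 "V e"] assms V by auto
  moreover have "(V e has_derivative (\<lambda>f. W e f x)) (at x)"
    using assms C2jetD(2) by blast
  ultimately have "(\<lambda>f. W e f x) = (\<lambda>e. 0)"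
    using has_derivative_unique by blast
  thus "W e f x = 0" by metis
qed

lemma C2jet_mvt2:
  fixes v :: "'a::euclidean_space \<Rightarrow> real"
  assumes J: "C2jet U v V W" and U: "open U" and h: "0 < h"
    and sub: "\<And>s r. 0 \<le> s \<Longrightarrow> s \<le> h \<Longrightarrow> 0 \<le> r \<Longrightarrow> r \<le> h \<Longrightarrow> x + s *\<^sub>R e + r *\<^sub>R f \<in> U"
  obtains s r where "0 \<le> s" "s \<le> h" "0 \<le> r" "r \<le> h"
    "v (x + h *\<^sub>R e + h *\<^sub>R f) - v (x + h *\<^sub>R e) - (v (x + h *\<^sub>R f) - v x)
      = h * h * W f e (x + s *\<^sub>R e + r *\<^sub>R f)"
proof -
  have d1: "((\<lambda>r. v (x + s *\<^sub>R e + r *\<^sub>R f)) has_real_derivative V f (x + s *\<^sub>R e + r *\<^sub>R f)) (at r)"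
    if "0 \<le> s" "s \<le> h" "0 \<le> r" "r \<le> h" for s r
  proof -
    have "((\<lambda>r. x + s *\<^sub>R e + r *\<^sub>R f) has_derivative (\<lambda>r. r *\<^sub>R f)) (at r)"
      by (auto intro!: derivative_eq_intros)
    from has_derivative_compose[OF this C2jetD(1)[OF J sub[OF that]]]
    have "((\<lambda>r. v (x + s *\<^sub>R e + r *\<^sub>R f)) has_derivative (\<lambda>t. V (t *\<^sub>R f) (x + s *\<^sub>R e + r *\<^sub>R f))) (at r)" .
    moreover have "V (t *\<^sub>R f) (x + s *\<^sub>R e + r *\<^sub>R f) = V f (x + s *\<^sub>R e + r *\<^sub>R f) * t" for t
      using linear_cmul[OF has_derivative_linear[OF C2jetD(1)[OF J sub[OF that]]]] by simp
    ultimately show ?thesis unfolding has_field_derivative_def by (simp add: mult_commute_abs)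
  qed
  have d2: "((\<lambda>s. V f (x + s *\<^sub>R e + r *\<^sub>R f)) has_real_derivative W f e (x + s *\<^sub>R e + r *\<^sub>R f)) (at s)"
    if "0 \<le> s" "s \<le> h" "0 \<le> r" "r \<le> h" for s r
  proof -
    have "((\<lambda>s. x + s *\<^sub>R e + r *\<^sub>R f) has_derivative (\<lambda>r. r *\<^sub>R e)) (at s)"
      by (auto intro!: derivative_eq_intros)
    from has_derivative_compose[OF this C2jetD(2)[OF J sub[OF that]]]
    have "((\<lambda>s. V f (x + s *\<^sub>R e + r *\<^sub>R f)) has_derivative (\<lambda>t. W f (t *\<^sub>R e) (x + s *\<^sub>R e + r *\<^sub>R f))) (at s)" .
    moreover have "W f (t *\<^sub>R e) (x + s *\<^sub>R e + r *\<^sub>R f) = W f e (x + s *\<^sub>R e + r *\<^sub>R f) * t" for t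
      using linear_cmul[OF has_derivative_linear[OF C2jetD(2)[OF J sub[OF that]]]] by simp
    ultimately show ?thesis unfolding has_field_derivative_def by (simp add: mult_commute_abs)
  qed
  define p where "p r = v (x + h *\<^sub>R e + r *\<^sub>R f) - v (x + 0 *\<^sub>R e + r *\<^sub>R f)" for r
  have "\<exists>r. 0 < r \<and> r < h \<and> p h - p 0 = (h - 0) * (V f (x + h *\<^sub>R e + r *\<^sub>R f) - V f (x + 0 *\<^sub>R e + r *\<^sub>R f))"
    unfolding p_def using h by (intro MVT2 DERIV_diff d1) auto
  then obtain r where r: "0 < r" "r < h" 
    "p h - p 0 = h * (V f (x + h *\<^sub>R e + r *\<^sub>R f) - V f (x + 0 *\<^sub>R e + r *\<^sub>R f))" by auto
  have "\<exists>s. 0 < s \<and> s < h \<and> V f (x + h *\<^sub>R e + r *\<^sub>R f) - V f (x + 0 *\<^sub>R e + r *\<^sub>R f)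
      = (h - 0) * W f e (x + s *\<^sub>R e + r *\<^sub>R f)"
    using h r by (intro MVT2 d2) auto
  then obtain s where s: "0 < s" "s < h" "V f (x + h *\<^sub>R e + r *\<^sub>R f) - V f (x + 0 *\<^sub>R e + r *\<^sub>R f)
      = h * W f e (x + s *\<^sub>R e + r *\<^sub>R f)" by auto
  show ?thesis
    by (rule that[of s r]) (use r s in \<open>auto simp: p_def algebra_simps\<close>)
qed

lemma C2jet_symmetric:
  assumes J: "C2jet U v V W" and U: "open U" and x: "x \<in> U"
  shows "W e f x = W f e x"
proof (rule ccontr)
  assume ne: "W e f x \<noteq> W f e x"
  define d where "d = \<bar>W e f x - W f e x\<bar> / 2"
  have d: "d > 0" using ne by (simp add: d_def)
  have cont: "isCont (W a b) x" for a b
    using C2jetD(3)[OF J] U x continuous_on_eq_continuous_at by blast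
  obtain d1 where d1: "d1 > 0" "\<And>y. dist y x < d1 \<Longrightarrow> dist (W e f y) (W e f x) < d"
    using cont[of e f] d unfolding continuous_at_eps_delta by blast
  obtain d2 where d2: "d2 > 0" "\<And>y. dist y x < d2 \<Longrightarrow> dist (W f e y) (W f e x) < d"
    using cont[of f e] d unfolding continuous_at_eps_delta by blast
  obtain d3 where d3: "d3 > 0" "ball x d3 \<subseteq> U"
    using U x openE by blast
  define m where "m = min d1 (min d2 d3)"
  have m: "m > 0" using d1 d2 d3 by (simp add: m_def)
  define h where "h = m / (2 * (norm e + norm f + 1))"
  have h: "h > 0" using m by (simp add: h_def add_nonneg_pos)
  have near: "dist (x + s *\<^sub>R e + r *\<^sub>R f) x < m" if "0 \<le> s" "s \<le> h" "0 \<le> r" "r \<le> h" for s r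
  proof -
    have "dist (x + s *\<^sub>R e + r *\<^sub>R f) x = norm (s *\<^sub>R e + r *\<^sub>R f)"
      by (simp add: dist_norm algebra_simps)
    also have "\<dots> \<le> s * norm e + r * norm f"
      using that by (metis abs_of_nonneg norm_scaleR norm_triangle_ineq)
    also have "\<dots> \<le> h * norm e + h * norm f"
      using that by (intro add_mono mult_right_mono) auto
    also have "\<dots> < h * (2 * (norm e + norm f + 1))"
      using h by (simp add: algebra_simps add_nonneg_pos)
    also have "\<dots> = m"
    proof -
      have "norm e + norm f + 1 > 0" by (simp add: add_nonneg_pos)
      thus ?thesis unfolding h_def by (simp add: field_simps)
    qed
    finally show ?thesis .
  qed
  have sub: "x + s *\<^sub>R e + r *\<^sub>R f \<in> U" if "0 \<le> s" "s \<le> h" "0 \<le> r" "r \<le> h" for s r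
    using near[OF that] d3 by (auto simp: m_def dist_commute)
  obtain s r where 1: "0 \<le> s" "s \<le> h" "0 \<le> r" "r \<le> h"
    "v (x + h *\<^sub>R e + h *\<^sub>R f) - v (x + h *\<^sub>R e) - (v (x + h *\<^sub>R f) - v x)
      = h * h * W f e (x + s *\<^sub>R e + r *\<^sub>R f)"
    using C2jet_mvt2[OF J U h sub] by blast
  have sub': "x + s *\<^sub>R f + r *\<^sub>R e \<in> U" if "0 \<le> s" "s \<le> h" "0 \<le> r" "r \<le> h" for s r
    using sub[of r s] that by (simp add: ac_simps)
  obtain s' r' where 2: "0 \<le> s'" "s' \<le> h" "0 \<le> r'" "r' \<le> h"
    "v (x + h *\<^sub>R f + h *\<^sub>R e) - v (x + h *\<^sub>R f) - (v (x + h *\<^sub>R e) - v x)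
      = h * h * W e f (x + s' *\<^sub>R f + r' *\<^sub>R e)"
    using C2jet_mvt2[OF J U h sub'] by blast
  have "v (x + h *\<^sub>R f + h *\<^sub>R e) = v (x + h *\<^sub>R e + h *\<^sub>R f)"
    by (simp add: ac_simps)
  hence "h * h * W f e (x + s *\<^sub>R e + r *\<^sub>R f) = h * h * W e f (x + s' *\<^sub>R f + r' *\<^sub>R e)"
    using 1 2 by linarith
  hence eq: "W f e (x + s *\<^sub>R e + r *\<^sub>R f) = W e f (x + s' *\<^sub>R f + r' *\<^sub>R e)"
    using h by simp
  have "dist (W f e (x + s *\<^sub>R e + r *\<^sub>R f)) (W f e x) < d"
    using near[of s r] 1 d2 by (auto simp: m_def)
  moreover have "dist (W e f (x + s' *\<^sub>R f + r' *\<^sub>R e)) (W e f x) < d"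
    using near[of r' s'] 2 d1 by (auto simp: m_def ac_simps)
  ultimately show False
    using eq dist_triangle2[of "W e f x" "W f e x" "W e f (x + s' *\<^sub>R f + r' *\<^sub>R e)"]
    unfolding d_def dist_real_def by (simp add: abs_minus_commute)
qed

lemma C2jet_mult:
  assumes "C2jet U v V W" "C2jet U v' V' W'"
  shows "C2jet U (\<lambda>x. v x * v' x) (\<lambda>e x. V e x * v' x + v x * V' e x)
    (\<lambda>e f x. W e f x * v' x + V e x * V' f x + V f x * V' e x + v x * W' e f x)"
proof (rule C2jetI)
  fix x assume x: "x \<in> U"
  note d = C2jetD(1,2)[OF assms(1) x] C2jetD(1,2)[OF assms(2) x]
  show "((\<lambda>x. v x * v' x) has_derivative (\<lambda>e. V e x * v' x + v x * V' e x)) (at x)"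
    by (rule derivative_eq_intros d refl)+ (auto simp: algebra_simps)
  show "((\<lambda>x. V e x * v' x + v x * V' e x) has_derivative
     (\<lambda>f. W e f x * v' x + V e x * V' f x + V f x * V' e x + v x * W' e f x)) (at x)" for e
    by (rule derivative_eq_intros d refl)+ (auto simp: algebra_simps)
qed (intro continuous_intros C2jetD[OF assms(1)] C2jetD[OF assms(2)])

lemma C2jet_exp:
  assumes "C2jet U v V W"
  shows "C2jet U (\<lambda>x. exp (v x)) (\<lambda>e x. exp (v x) * V e x)
    (\<lambda>e f x. exp (v x) * (V e x * V f x + W e f x))"
proof (rule C2jetI)
  fix x assume x: "x \<in> U"
  note d = C2jetD(1,2)[OF assms(1) x]
  show "((\<lambda>x. exp (v x)) has_derivative (\<lambda>e. exp (v x) * V e x)) (at x)"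
    by (rule derivative_eq_intros d refl)+ (auto simp: algebra_simps)
  show "((\<lambda>x. exp (v x) * V e x) has_derivative
     (\<lambda>f. exp (v x) * (V e x * V f x + W e f x))) (at x)" for e
    by (rule derivative_eq_intros d refl)+ (auto simp: algebra_simps)
qed (intro continuous_intros C2jetD[OF assms(1)])

lemma has_derivative_zero_open:
  assumes "open S" "x \<in> S" "\<And>y. y \<in> S \<Longrightarrow> g y = 0"
  shows "(g has_derivative (\<lambda>_. 0)) (at x)"
  by (rule has_derivative_transform_within_open[OF has_derivative_const[of 0] assms(1,2)])
    (use assms in auto)

lemma C2jet_mult_cutoff:
  assumes X: "C2jet UNIV X X' X''" and v: "C2jet U v V W" and "open U" "closed K" "K \<subseteq> U"
    and 0: "\<And>x. x \<notin> K \<Longrightarrow> X x = 0"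
  shows "C2jet UNIV (\<lambda>x. X x * v x) (\<lambda>e x. X' e x * v x + X x * V e x)
    (\<lambda>e f x. X'' e f x * v x + X' e x * V f x + X' f x * V e x + X x * W e f x)"
proof -
  have "C2jet U (\<lambda>x. X x * v x) (\<lambda>e x. X' e x * v x + X x * V e x)
    (\<lambda>e f x. X'' e f x * v x + X' e x * V f x + X' f x * V e x + X x * W e f x)"
    by (intro C2jet_mult v C2jet_subset[OF X]) simp
  moreover have "C2jet (-K) (\<lambda>x. X x * v x) (\<lambda>e x. X' e x * v x + X x * V e x)
    (\<lambda>e f x. X'' e f x * v x + X' e x * V f x + X' f x * V e x + X x * W e f x)"
  proof -
    have o: "open (-K)" using assms by auto
    have z: "X x = 0" "X' e x = 0" "X'' e f x = 0" if "x \<in> -K" for x e f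
      using C2jet_locally_const[OF X o, of 0 x] 0 that by auto
    show ?thesis
    proof (rule C2jetI)
      fix x assume x: "x \<in> -K"
      show "((\<lambda>x. X x * v x) has_derivative (\<lambda>e. X' e x * v x + X x * V e x)) (at x)"
        using has_derivative_zero_open[OF o x, of "\<lambda>x. X x * v x"] z x by simp
      show "((\<lambda>x. X' e x * v x + X x * V e x) has_derivative
         (\<lambda>f. X'' e f x * v x + X' e x * V f x + X' f x * V e x + X x * W e f x)) (at x)" for e
        using has_derivative_zero_open[OF o x, of "\<lambda>x. X' e x * v x + X x * V e x"] z x by simp
    next
      fix e f
      show "continuous_on (-K) (\<lambda>x. X'' e f x * v x + X' e x * V f x + X' f x * V e x + X x * W e f x)"
        using z by (auto intro: continuous_on_eq[OF continuous_on_const[of _ 0]])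
    qed
  qed
  ultimately have "C2jet (U \<union> -K) (\<lambda>x. X x * v x) (\<lambda>e x. X' e x * v x + X x * V e x)
    (\<lambda>e f x. X'' e f x * v x + X' e x * V f x + X' f x * V e x + X x * W e f x)"
    by (rule C2jet_union) (use assms in auto)
  moreover have "U \<union> -K = UNIV" using assms by auto
  ultimately show ?thesis by simp
qed

lemma C2_on_imp_C2jet:
  fixes u :: "'a::euclidean_space \<Rightarrow> real"
  assumes "C2_on U u"
  obtains V W where "C2jet U u V W"
proof -
  obtain f' :: "'a \<Rightarrow> 'a \<Rightarrow>\<^sub>L real" and f'' :: "'a \<Rightarrow> 'a \<Rightarrow>\<^sub>L ('a \<Rightarrow>\<^sub>L real)" where
    f: "\<And>x. x\<in>U \<Longrightarrow> (u has_derivative blinfun_apply (f' x)) (at x)"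
       "\<And>x. x\<in>U \<Longrightarrow> (f' has_derivative blinfun_apply (f'' x)) (at x)"
       "continuous_on U f''"
    using assms unfolding C2_on_def by blast
  have "C2jet U u (\<lambda>e x. f' x e) (\<lambda>e f x. f'' x f e)"
  proof (rule C2jetI)
    fix x assume "x \<in> U"
    show "(u has_derivative (\<lambda>e. f' x e)) (at x)" using f \<open>x \<in> U\<close> by auto
    show "((\<lambda>x. f' x e) has_derivative (\<lambda>f. f'' x f e)) (at x)" for e
      by (rule bounded_linear.has_derivative[OF blinfun.bounded_linear_left f(2)[OF \<open>x \<in> U\<close>]])
  qed (intro continuous_intros f)
  thus ?thesis by (rule that)
qed

lemma C2jet_compose:
  assumes "C2jet UNIV q Q R"
    and F: "\<And>s. (F has_real_derivative F' s) (at s)" "\<And>s. (F' has_real_derivative F'' s) (at s)"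
       "continuous_on UNIV F''"
  shows "C2jet UNIV (\<lambda>p. F (q p)) (\<lambda>e p. F' (q p) * Q e p)
     (\<lambda>e f p. F'' (q p) * Q e p * Q f p + F' (q p) * R e f p)"
proof (rule C2jetI)
  fix x
  have d: "(q has_derivative (\<lambda>e. Q e x)) (at x)"
    by (rule C2jetD(1)[OF assms(1) UNIV_I])
  have dF: "((\<lambda>p. F (q p)) has_derivative (\<lambda>e. F' (q x) * Q e x)) (at x)"
    using has_derivative_compose[OF d F(1)[unfolded has_field_derivative_def]] .
  have dF': "((\<lambda>p. F' (q p)) has_derivative (\<lambda>e. F'' (q x) * Q e x)) (at x)"
    using has_derivative_compose[OF d F(2)[unfolded has_field_derivative_def]] .
  show "((\<lambda>p. F (q p)) has_derivative (\<lambda>e. F' (q x) * Q e x)) (at x)" by (rule dF)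
  have dQ: "(Q e has_derivative (\<lambda>f. R e f x)) (at x)" for e
    by (rule C2jetD(2)[OF assms(1) UNIV_I])
  show "((\<lambda>p. F' (q p) * Q e p) has_derivative
      (\<lambda>f. F'' (q x) * Q e x * Q f x + F' (q x) * R e f x)) (at x)" for e
    by (rule derivative_eq_intros dQ dF' refl)+ (auto simp: algebra_simps)
next
  fix e f
  have "isCont F' s" for s using F(2)[of s] by (rule DERIV_isCont)
  hence "continuous_on UNIV F'" by (simp add: continuous_at_imp_continuous_on)
  hence F'q: "continuous_on UNIV (\<lambda>p. F' (q p))"
    using continuous_on_compose2[OF _ C2jetD(5)[OF assms(1)], of UNIV F'] by simp
  have F''q: "continuous_on UNIV (\<lambda>p. F'' (q p))"
    using continuous_on_compose2[OF F(3) C2jetD(5)[OF assms(1)]] by simp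
  show "continuous_on UNIV (\<lambda>p. F'' (q p) * Q e p * Q f p + F' (q p) * R e f p)"
    by (intro continuous_intros F'q F''q C2jetD(3,4)[OF assms(1)])
qed

lemma C2jet_fst: "C2jet UNIV (\<lambda>p. fst p) (\<lambda>e p. fst e) (\<lambda>e f p. 0)"
  by (rule C2jetI) (auto intro!: derivative_eq_intros)

definition sqd :: "'b::real_inner \<Rightarrow> 'a \<times> 'b \<Rightarrow> real"
  where "sqd x0 p = (snd p - x0) \<bullet> (snd p - x0)"

lemma C2jet_sqd: "C2jet UNIV (sqd x0) (\<lambda>e p. 2 * ((snd p - x0) \<bullet> snd e)) (\<lambda>e f p. 2 * (snd e \<bullet> snd f))"
  unfolding sqd_def
  by (rule C2jetI) (auto intro!: derivative_eq_intros continuous_intros simp: inner_commute inner_add algebra_simps)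

section \<open>Integration by parts\<close>

lemma has_directional_deriv:
  assumes "(w has_derivative D) (at x)"
  shows "((\<lambda>s. w (x + s *\<^sub>R e)) has_real_derivative D e) (at 0)"
proof -
  have "((\<lambda>s. x + s *\<^sub>R e) has_derivative (\<lambda>s. s *\<^sub>R e)) (at 0)"
    by (auto intro!: derivative_eq_intros)
  from has_derivative_compose[OF this, of w D]
  have "((\<lambda>s. w (x + s *\<^sub>R e)) has_derivative (\<lambda>s. D (s *\<^sub>R e))) (at 0)"
    using assms by simp
  moreover have "D (s *\<^sub>R e) = D e * s" for s
    using linear_cmul[OF has_derivative_linear[OF assms]] by simp
  ultimately show ?thesis unfolding has_field_derivative_def by simp
qed

lemma integrable_continuous_compact_support:
  fixes f :: "'a::euclidean_space \<Rightarrow> real"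
  assumes "continuous_on UNIV f" "compact K" "\<And>x. x \<notin> K \<Longrightarrow> f x = 0"
  shows "integrable lborel f"
proof -
  have "integrable lborel (\<lambda>x. indicator K x *\<^sub>R f x)"
    by (rule borel_integrable_compact) (use assms continuous_on_subset[of UNIV f K] in auto)
  moreover have "(\<lambda>x. indicator K x *\<^sub>R f x) = f"
    using assms by (auto simp: indicator_def fun_eq_iff)
  ultimately show ?thesis by simp
qed

text \<open>Differentiate the translation invariant function h \<mapsto> \<integral> w(x + h e) dx at h = 0.\<close>
lemma integral_directional_derivative_eq_0:
  fixes w :: "'a::euclidean_space \<Rightarrow> real"
  assumes w: "\<And>x. (w has_derivative (\<lambda>f. D f x)) (at x)" and cont: "continuous_on UNIV (D e)"
    and K: "compact K" "\<And>x. x \<notin> K \<Longrightarrow> w x = 0"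
  shows "integrable lborel (D e)" "(\<integral>x. D e x \<partial>lborel) = 0"
proof -
  have wc: "continuous_on UNIV w"
    using w by (meson continuous_at_imp_continuous_on has_derivative_continuous)
  have D0: "D f x = 0" if "x \<notin> K" for x f
  proof -
    have "(w has_derivative (\<lambda>e. 0)) (at x)"
      using has_derivative_zero_open[of "-K" x w] K that
      by (simp add: compact_imp_closed open_Compl)
    hence "(\<lambda>e. D e x) = (\<lambda>e. 0)" using w has_derivative_unique by blast
    thus ?thesis by metis
  qed
  show "integrable lborel (D e)"
    by (rule integrable_continuous_compact_support[OF cont K(1) D0])
  have wi: "integrable lborel w"
    by (rule integrable_continuous_compact_support[OF wc K])
  have dd: "((\<lambda>s. w (x + s *\<^sub>R e)) has_real_derivative D e (x + s *\<^sub>R e)) (at s)" for x s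
  proof -
    have "((\<lambda>r. w ((x + s *\<^sub>R e) + r *\<^sub>R e)) has_real_derivative D e (x + s *\<^sub>R e)) (at 0)"
      using has_directional_deriv[OF w[of "x + s *\<^sub>R e"]] .
    moreover have "(\<lambda>r. w ((x + s *\<^sub>R e) + r *\<^sub>R e)) = (\<lambda>r. w (x + (r + s) *\<^sub>R e))"
      by (auto simp: algebra_simps)
    ultimately show ?thesis
      using DERIV_shift[of "\<lambda>s. w (x + s *\<^sub>R e)" "D e (x + s *\<^sub>R e)" 0 s] by (simp add: ac_simps)
  qed
  define K' where "K' = (\<lambda>z. fst z - snd z *\<^sub>R e) ` (K \<times> {0..1::real})"
  have K': "compact K'"
    unfolding K'_def by (intro compact_continuous_image continuous_intros compact_Times K) auto
  obtain B where B: "\<And>x. \<bar>D e x\<bar> \<le> B"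
  proof -
    have "compact (D e ` K)" using cont K by (meson compact_continuous_image continuous_on_subset subset_UNIV)
    then obtain B where "\<And>x. x \<in> K \<Longrightarrow> norm (D e x) \<le> B"
      by (meson compact_imp_bounded bounded_iff imageI)
    hence "\<bar>D e x\<bar> \<le> max B 0" for x using D0[of x e] by (cases "x \<in> K") (auto simp: max.coboundedI1)
    thus ?thesis by (rule that)
  qed
  define h where "h n = inverse (real (Suc n))" for n
  have h: "0 < h n" "h n \<le> 1" for n
    by (auto simp: h_def field_simps)
  have h0: "h \<longlonglongrightarrow> 0" unfolding h_def using LIMSEQ_inverse_real_of_nat by simp
  define q where "q n x = (w (x + h n *\<^sub>R e) - w x) / h n" for n x
  have q: "\<exists>s. 0 < s \<and> s < h n \<and> q n x = D e (x + s *\<^sub>R e)" for n x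
  proof -
    have "\<exists>s. 0 < s \<and> s < h n \<and> w (x + h n *\<^sub>R e) - w (x + 0 *\<^sub>R e) = (h n - 0) * D e (x + s *\<^sub>R e)"
      using h dd by (intro MVT2) auto
    thus ?thesis using h[of n] by (auto simp: q_def)
  qed
  have bound: "norm (q n x) \<le> B * indicator K' x" for n x
  proof (cases "x \<in> K'")
    case True thus ?thesis using q[of n x] B by auto
  next
    case False
    obtain s where s: "0 < s" "s < h n" "q n x = D e (x + s *\<^sub>R e)" using q by blast
    have "x + s *\<^sub>R e \<notin> K"
    proof
      assume "x + s *\<^sub>R e \<in> K"
      hence "(x + s *\<^sub>R e) - s *\<^sub>R e \<in> K'"
        unfolding K'_def using s h[of n] by (auto intro!: image_eqI[of _ _ "(x + s *\<^sub>R e, s)"])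
      thus False using False by simp
    qed
    thus ?thesis using s D0 False by auto
  qed
  have lim: "(\<lambda>n. q n x) \<longlonglongrightarrow> D e x" for x
  proof -
    have "((\<lambda>s. (w (x + s *\<^sub>R e) - w x) / s) \<longlongrightarrow> D e x) (at 0)"
      using dd[of x 0] by (simp add: DERIV_def)
    moreover have "filterlim h (at 0) sequentially"
      unfolding filterlim_at using h0 h by (simp add: less_imp_neq[symmetric])
    ultimately show ?thesis unfolding q_def by (rule filterlim_compose)
  qed
  have wsh: "integrable lborel (\<lambda>x. w (x + a))" "(\<integral>x. w (x + a) \<partial>lborel) = (\<integral>x. w x \<partial>lborel)" for a
  proof -
    have m: "(\<lambda>x. a + x) \<in> borel_measurable lborel" "w \<in> borel_measurable lborel"
      using borel_measurable_continuous_onI[OF wc]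
        borel_measurable_continuous_onI[OF continuous_on_add[OF continuous_on_const continuous_on_id], of a]
      by simp_all
    have "integrable (distr lborel borel (\<lambda>x. a + x)) w"
      using wi by (simp add: lborel_distr_plus)
    thus "integrable lborel (\<lambda>x. w (x + a))"
      using m by (subst (asm) integrable_distr_eq) (simp_all add: add.commute)
    have "(\<integral>x. w x \<partial>lborel) = (\<integral>x. w x \<partial>(distr lborel borel (\<lambda>x. a + x)))"
      by (simp add: lborel_distr_plus)
    also have "\<dots> = (\<integral>x. w (x + a) \<partial>lborel)"
      using m by (subst integral_distr) (simp_all add: add.commute)
    finally show "(\<integral>x. w (x + a) \<partial>lborel) = (\<integral>x. w x \<partial>lborel)" by simp
  qed
  have q0: "(\<integral>x. q n x \<partial>lborel) = 0" for n
    unfolding q_def using wsh wi by simp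
  have "(\<lambda>n. \<integral>x. q n x \<partial>lborel) \<longlonglongrightarrow> (\<integral>x. D e x \<partial>lborel)"
  proof (rule integral_dominated_convergence[where w = "\<lambda>x. B * indicator K' x"])
    show "D e \<in> borel_measurable lborel" using \<open>integrable lborel (D e)\<close> by simp
    show "q n \<in> borel_measurable lborel" for n
      unfolding q_def using wsh wi by (intro borel_measurable_divide borel_measurable_diff) auto
    show "integrable lborel (\<lambda>x. B * indicator K' x)"
      using K' emeasure_compact_finite[OF K']
      by (intro integrable_mult_right integrable_real_indicator) (auto simp: compact_imp_closed)
  qed (use lim bound in auto)
  thus "(\<integral>x. D e x \<partial>lborel) = 0"
    using q0 by (simp add: LIMSEQ_const_iff)
qed

abbreviation et :: "real \<times> (real^'n::finite)" where "et \<equiv> (1, 0)"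
abbreviation ex :: "'n \<Rightarrow> real \<times> (real^'n::finite)" where "ex i \<equiv> (0, axis i 1)"

text \<open>The difference 2 M R - Q is the space-time divergence of the field (Y, X) defined in the proof,
  which is only C^1 because v is only C^2.\<close>
lemma carleman_integral_identity:
  fixes v :: "real \<times> (real^'n::finite) \<Rightarrow> real" and P :: "'n \<Rightarrow> real \<times> (real^'n) \<Rightarrow> real"
  assumes v: "C2jet UNIV v V W" and K: "compact K" "\<And>p. p \<notin> K \<Longrightarrow> v p = 0"
    and P: "\<And>i p. (P i has_derivative (\<lambda>e. P' i e p)) (at p)" "\<And>i e. continuous_on UNIV (P' i e)"
    and b: "\<And>p. (b has_derivative (\<lambda>e. b' e p)) (at p)" "\<And>e. continuous_on UNIV (b' e)"
    and k: "\<And>p. (k has_derivative (\<lambda>e. k' e p)) (at p)" "\<And>e. continuous_on UNIV (k' e)"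
  defines "Sq \<equiv> \<lambda>p. \<Sum>i\<in>UNIV. (V (ex i) p)\<^sup>2"
    and "G \<equiv> \<lambda>p. \<Sum>i\<in>UNIV. P i p * V (ex i) p"
    and "A \<equiv> \<lambda>p. \<Sum>i\<in>UNIV. W (ex i) (ex i) p"
    and "divP \<equiv> \<lambda>p. \<Sum>i\<in>UNIV. P' i (ex i) p"
  defines "M \<equiv> \<lambda>p. V et p + 2 * G p + b p * v p"
    and "R \<equiv> \<lambda>p. - A p - k p * v p"
    and "Q \<equiv> \<lambda>p. 4 * (\<Sum>i\<in>UNIV. \<Sum>j\<in>UNIV. P' j (ex i) p * V (ex i) p * V (ex j) p)
        - 2 * divP p * Sq p + 2 * b p * Sq p + 2 * v p * (\<Sum>i\<in>UNIV. b' (ex i) p * V (ex i) p)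
        + (k' et p + 2 * ((\<Sum>i\<in>UNIV. k' (ex i) p * P i p) + k p * divP p) - 2 * b p * k p) * (v p)\<^sup>2"
  shows "integrable lborel (\<lambda>p. 2 * M p * R p)" "integrable lborel Q"
    "(\<integral>p. 2 * M p * R p \<partial>lborel) = (\<integral>p. Q p \<partial>lborel)"
proof -
  note dv = C2jetD(1)[OF v UNIV_I]
  have dV: "(V e has_derivative (\<lambda>f. W e f x)) (at x)" for e x by (rule C2jetD(2)[OF v UNIV_I])
  have sym: "W e f x = W f e x" for e f x by (rule C2jet_symmetric[OF v]) auto
  have Pc: "continuous_on UNIV (P i)" for i
    using P(1) by (meson continuous_at_imp_continuous_on has_derivative_continuous)
  have bc: "continuous_on UNIV b"
    using b(1) by (meson continuous_at_imp_continuous_on has_derivative_continuous)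
  have kc: "continuous_on UNIV k"
    using k(1) by (meson continuous_at_imp_continuous_on has_derivative_continuous)
  note cont = C2jetD(3,4,5)[OF v] P(2) b(2) k(2) Pc bc kc
  have z: "V e p = 0" "W e f p = 0" if "p \<notin> K" for e f p
    using C2jet_locally_const(1)[OF v, of "-K" 0 p e] C2jet_locally_const(2)[OF v, of "-K" 0 p e f] K that
    by (auto simp: compact_imp_closed open_Compl)
  show i1: "integrable lborel (\<lambda>p. 2 * M p * R p)"
    by (rule integrable_continuous_compact_support[OF _ K(1)])
      (auto simp: M_def R_def G_def A_def K z intro!: continuous_intros cont)
  show i2: "integrable lborel Q"
    by (rule integrable_continuous_compact_support[OF _ K(1)])
      (auto simp: Q_def Sq_def divP_def K z intro!: continuous_intros cont)
  define dSq where "dSq e p = (\<Sum>i\<in>UNIV. 2 * V (ex i) p * W (ex i) e p)" for e p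
  define dG where "dG e p = (\<Sum>j\<in>UNIV. P' j e p * V (ex j) p + P j p * W (ex j) e p)" for e p
  have Sq: "(Sq has_derivative (\<lambda>e. dSq e p)) (at p)" for p
    unfolding Sq_def dSq_def by (rule derivative_eq_intros dV refl)+ (auto simp: algebra_simps)
  have G: "(G has_derivative (\<lambda>e. dG e p)) (at p)" for p
    unfolding G_def dG_def by (rule derivative_eq_intros dV P refl)+ (auto simp: algebra_simps)
  define Y where "Y p = Sq p - k p * (v p)\<^sup>2" for p
  define Y' where "Y' e p = dSq e p - k' e p * (v p)\<^sup>2 - 2 * k p * v p * V e p" for e p
  define X where "X i p = - 2 * V et p * V (ex i) p - 4 * V (ex i) p * G p + 2 * P i p * Sq p
    - 2 * b p * v p * V (ex i) p - 2 * k p * P i p * (v p)\<^sup>2" for i p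
  define X' where "X' i e p = - 2 * (W et e p * V (ex i) p + V et p * W (ex i) e p)
    - 4 * (W (ex i) e p * G p + V (ex i) p * dG e p)
    + 2 * (P' i e p * Sq p + P i p * dSq e p)
    - 2 * (b' e p * v p * V (ex i) p + b p * V e p * V (ex i) p + b p * v p * W (ex i) e p)
    - 2 * (k' e p * P i p * (v p)\<^sup>2 + k p * P' i e p * (v p)\<^sup>2 + 2 * k p * P i p * v p * V e p)" for i e p
  have Y: "(Y has_derivative (\<lambda>e. Y' e p)) (at p)" for p
    unfolding Y_def Y'_def by (rule derivative_eq_intros dv k Sq refl)+ (auto simp: algebra_simps)
  have X: "(X i has_derivative (\<lambda>e. X' i e p)) (at p)" for i p
    unfolding X_def X'_def
    by (rule derivative_eq_intros dv dV P b k Sq G refl)+ (auto simp: algebra_simps power2_eq_square)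
  have Yi: "integrable lborel (Y' et)" "(\<integral>p. Y' et p \<partial>lborel) = 0"
  proof -
    have "continuous_on UNIV (Y' et)"
      unfolding Y'_def dSq_def by (intro continuous_intros cont)
    moreover have "Y p = 0" if "p \<notin> K" for p using that by (simp add: Y_def Sq_def z K)
    ultimately show "integrable lborel (Y' et)" "(\<integral>p. Y' et p \<partial>lborel) = 0"
      using integral_directional_derivative_eq_0[OF Y _ K(1)] by blast+
  qed
  have Xi: "integrable lborel (X' i (ex i))" "(\<integral>p. X' i (ex i) p \<partial>lborel) = 0" for i
  proof -
    have "continuous_on UNIV (X' i (ex i))"
      unfolding X'_def dSq_def Sq_def dG_def G_def by (intro continuous_intros cont)
    moreover have "X i p = 0" if "p \<notin> K" for p using that by (simp add: X_def Sq_def z K)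
    ultimately show "integrable lborel (X' i (ex i))" "(\<integral>p. X' i (ex i) p \<partial>lborel) = 0"
      using integral_directional_derivative_eq_0[OF X _ K(1)] by blast+
  qed
  have "2 * M p * R p - Q p = Y' et p + (\<Sum>i\<in>UNIV. X' i (ex i) p)" for p
  proof -
    define S1 where "S1 = (\<Sum>i\<in>UNIV. W et (ex i) p * V (ex i) p)"
    define S2 where "S2 = (\<Sum>i\<in>UNIV. V (ex i) p * dG (ex i) p)"
    define S3 where "S3 = (\<Sum>i\<in>UNIV. P i p * dSq (ex i) p)"
    define B where "B = (\<Sum>i\<in>UNIV. b' (ex i) p * V (ex i) p)"
    define KP where "KP = (\<Sum>i\<in>UNIV. k' (ex i) p * P i p)"
    define PP where "PP = (\<Sum>i\<in>UNIV. \<Sum>j\<in>UNIV. P' j (ex i) p * V (ex i) p * V (ex j) p)"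
    define H where "H = (\<Sum>i\<in>UNIV. \<Sum>j\<in>UNIV. V (ex i) p * P j p * W (ex j) (ex i) p)"
    have 1: "(\<Sum>i\<in>UNIV. X' i (ex i) p) = - 2 * (S1 + V et p * A p) - 4 * (A p * G p + S2)
      + 2 * (divP p * Sq p + S3) - 2 * (v p * B + b p * (\<Sum>i\<in>UNIV. (V (ex i) p)\<^sup>2) + b p * v p * A p)
      - 2 * (KP * (v p)\<^sup>2 + k p * divP p * (v p)\<^sup>2 + 2 * k p * v p * (\<Sum>i\<in>UNIV. P i p * V (ex i) p))"
      unfolding S1_def S2_def S3_def B_def KP_def A_def X'_def divP_def
      by (simp add: sum.distrib sum_subtractf sum_distrib_left sum_distrib_right algebra_simps power2_eq_square sum_negf)
    have 2: "dSq et p = 2 * S1"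
      unfolding dSq_def S1_def by (simp add: sum_distrib_left sym[of _ et] mult_ac)
    have 3: "S2 = PP + H"
      unfolding S2_def PP_def H_def dG_def
      by (simp add: sum.distrib sum_distrib_left algebra_simps)
    have 4: "S3 = 2 * H"
    proof -
      have "S3 = (\<Sum>i\<in>UNIV. \<Sum>j\<in>UNIV. 2 * (P i p * V (ex j) p * W (ex j) (ex i) p))"
        unfolding S3_def dSq_def by (simp add: sum_distrib_left algebra_simps)
      also have "\<dots> = (\<Sum>j\<in>UNIV. \<Sum>i\<in>UNIV. 2 * (P i p * V (ex j) p * W (ex j) (ex i) p))"
        by (rule sum.swap)
      also have "\<dots> = (\<Sum>j\<in>UNIV. \<Sum>i\<in>UNIV. 2 * (V (ex j) p * P i p * W (ex i) (ex j) p))"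
        using sym by (simp add: mult_ac)
      also have "\<dots> = 2 * H" unfolding H_def by (simp add: sum_distrib_left)
      finally show ?thesis .
    qed
    have 5: "(\<Sum>i\<in>UNIV. (V (ex i) p)\<^sup>2) = Sq p" "(\<Sum>i\<in>UNIV. P i p * V (ex i) p) = G p"
      by (simp_all add: Sq_def G_def)
    show ?thesis
      unfolding 1 5 3 4 Y'_def 2 M_def R_def Q_def B_def[symmetric] KP_def[symmetric] PP_def[symmetric]
      by (simp add: algebra_simps power2_eq_square)
  qed
  hence "(\<integral>p. 2 * M p * R p - Q p \<partial>lborel) = (\<integral>p. Y' et p + (\<Sum>i\<in>UNIV. X' i (ex i) p) \<partial>lborel)"
    by simp
  also have "\<dots> = 0" using Yi Xi by simp
  finally show "(\<integral>p. 2 * M p * R p \<partial>lborel) = (\<integral>p. Q p \<partial>lborel)" using i1 i2 by simp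
qed

section \<open>The Carleman estimate\<close>

lemma bounded_on_compact:
  fixes f :: "'a::topological_space \<Rightarrow> real"
  assumes "compact K" "continuous_on K f"
  obtains B where "0 \<le> B" "\<And>x. x \<in> K \<Longrightarrow> \<bar>f x\<bar> \<le> B"
proof -
  have "bounded (f ` K)" using assms by (intro compact_imp_bounded compact_continuous_image)
  then obtain B where "0 < B" "\<And>y. y \<in> f ` K \<Longrightarrow> norm y \<le> B" by (auto simp: bounded_pos)
  thus ?thesis by (intro that[of B]) auto
qed

lemma conjugated_heat_operator:
  fixes w \<Phi> k b :: "real \<times> (real^'n::finite) \<Rightarrow> real"
    and V \<Phi>' :: "real \<times> (real^'n) \<Rightarrow> real \<times> (real^'n) \<Rightarrow> real"
    and W \<Phi>'' :: "real \<times> (real^'n) \<Rightarrow> real \<times> (real^'n) \<Rightarrow> real \<times> (real^'n) \<Rightarrow> real"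
  defines "v' \<equiv> \<lambda>e p. exp (\<Phi> p) * \<Phi>' e p * w p + exp (\<Phi> p) * V e p"
    and "v'' \<equiv> \<lambda>e f p. exp (\<Phi> p) * (\<Phi>' e p * \<Phi>' f p + \<Phi>'' e f p) * w p + exp (\<Phi> p) * \<Phi>' e p * V f p
      + exp (\<Phi> p) * \<Phi>' f p * V e p + exp (\<Phi> p) * W e f p"
  assumes k: "k p = b p - (\<Sum>i\<in>UNIV. \<Phi>'' (ex i) (ex i) p) + (\<Sum>i\<in>UNIV. (\<Phi>' (ex i) p)\<^sup>2) + \<Phi>' et p"
  shows "(v' et p + 2 * (\<Sum>i\<in>UNIV. \<Phi>' (ex i) p * v' (ex i) p) + b p * (exp (\<Phi> p) * w p))
    + (- (\<Sum>i\<in>UNIV. v'' (ex i) (ex i) p) - k p * (exp (\<Phi> p) * w p))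
    = exp (\<Phi> p) * (V et p - (\<Sum>i\<in>UNIV. W (ex i) (ex i) p))"
proof -
  define X where "X = (\<Sum>i\<in>UNIV. \<Phi>' (ex i) p * V (ex i) p)"
  define Y where "Y = (\<Sum>i\<in>UNIV. (\<Phi>' (ex i) p)\<^sup>2)"
  define D where "D = (\<Sum>i\<in>UNIV. \<Phi>'' (ex i) (ex i) p)"
  define A where "A = (\<Sum>i\<in>UNIV. W (ex i) (ex i) p)"
  have 1: "(\<Sum>i\<in>UNIV. \<Phi>' (ex i) p * v' (ex i) p) = exp (\<Phi> p) * (Y * w p + X)"
    unfolding v'_def X_def Y_def
    by (simp add: sum.distrib sum_negf sum_distrib_left sum_distrib_right algebra_simps power2_eq_square)
  have 2: "(\<Sum>i\<in>UNIV. v'' (ex i) (ex i) p) = exp (\<Phi> p) * ((Y + D) * w p + 2 * X + A)"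
    unfolding v''_def X_def Y_def D_def A_def
    by (simp add: sum.distrib sum_negf sum_distrib_left sum_distrib_right algebra_simps power2_eq_square)
  show ?thesis
    unfolding 1 2 k
    unfolding v'_def D_def[symmetric] Y_def[symmetric] A_def[symmetric] by (simp add: algebra_simps)
qed

lemma C2jet_carleman_weight:
  fixes x0 :: "real^'n::finite"
  assumes g: "\<And>t. (g has_real_derivative g' t) (at t)" "\<And>t. (g' has_real_derivative g'' t) (at t)"
    "continuous_on UNIV g''"
  shows "C2jet UNIV (\<lambda>p. \<tau> * (exp (- \<mu> * sqd x0 p) - g (fst p)))
    (\<lambda>e p. \<tau> * (- 2 * \<mu> * ((snd p - x0) \<bullet> snd e) * exp (- \<mu> * sqd x0 p) - g' (fst p) * fst e))
    (\<lambda>e f p. \<tau> * ((4 * \<mu>\<^sup>2 * ((snd p - x0) \<bullet> snd e) * ((snd p - x0) \<bullet> snd f) - 2 * \<mu> * (snd e \<bullet> snd f))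
        * exp (- \<mu> * sqd x0 p) - g'' (fst p) * fst e * fst f))"
proof (rule C2jetI)
  fix p :: "real \<times> (real^'n)" and e f :: "real \<times> (real^'n)"
  have s: "(sqd x0 has_derivative (\<lambda>e. 2 * ((snd p - x0) \<bullet> snd e))) (at p)"
    by (rule C2jetD(1)[OF C2jet_sqd UNIV_I])
  have G: "((\<lambda>p. g (fst p)) has_derivative (\<lambda>e. g' (fst p) * fst e)) (at p)"
    using C2jetD(1)[OF C2jet_compose[OF C2jet_fst g] UNIV_I, of p] .
  have G': "((\<lambda>p. g' (fst p)) has_derivative (\<lambda>e. g'' (fst p) * fst e)) (at p)"
    using has_derivative_compose[OF has_derivative_fst[OF has_derivative_ident] g(2)[unfolded has_field_derivative_def]] .
  show "((\<lambda>p. \<tau> * (exp (- \<mu> * sqd x0 p) - g (fst p))) has_derivative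
    (\<lambda>e. \<tau> * (- 2 * \<mu> * ((snd p - x0) \<bullet> snd e) * exp (- \<mu> * sqd x0 p) - g' (fst p) * fst e))) (at p)"
    by (rule derivative_eq_intros s G refl)+ (auto simp: algebra_simps)
  show "((\<lambda>p. \<tau> * (- 2 * \<mu> * ((snd p - x0) \<bullet> snd e) * exp (- \<mu> * sqd x0 p) - g' (fst p) * fst e)) has_derivative
    (\<lambda>f. \<tau> * ((4 * \<mu>\<^sup>2 * ((snd p - x0) \<bullet> snd e) * ((snd p - x0) \<bullet> snd f) - 2 * \<mu> * (snd e \<bullet> snd f))
        * exp (- \<mu> * sqd x0 p) - g'' (fst p) * fst e * fst f))) (at p)"
    by (rule derivative_eq_intros s G' refl)+ (auto simp: algebra_simps inner_commute power2_eq_square inner_diff)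
next
  fix e f :: "real \<times> (real^'n)"
  have g'': "continuous_on UNIV (\<lambda>p::real \<times> (real^'n). g'' (fst p))"
    using continuous_on_compose2[OF g(3) continuous_on_fst[OF continuous_on_id]] by simp
  show "continuous_on UNIV (\<lambda>p. \<tau> * ((4 * \<mu>\<^sup>2 * ((snd p - x0) \<bullet> snd e) * ((snd p - x0) \<bullet> snd f) - 2 * \<mu> * (snd e \<bullet> snd f))
        * exp (- \<mu> * sqd x0 p) - g'' (fst p) * fst e * fst f))"
    by (intro continuous_intros g'' C2jetD(5)[OF C2jet_sqd])
qed

text \<open>This is the quadratic form Q of the integral identity for the weight \<tau> (E - g(t)), E = exp(-\<mu> s),
  where s is the squared distance to the axis, Z the spatial derivative of v in the direction x - x0, and g1, g2
  the derivatives of g. The cross term in v Z is absorbed by the positive term in Z^2.\<close>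
lemma carleman_quadratic_form_lower_bound:
  fixes \<mu> \<tau> E s Sq Z v g1 g2 n :: real
  assumes "0 < \<mu>" "0 < \<tau>" "0 < E" "2 \<le> \<mu> * s"
  defines "b \<equiv> \<tau> * (4 * \<mu>\<^sup>2 * s - 2 * n * \<mu> + 8 * \<mu>) * E"
    and "k \<equiv> 8 * \<mu> * \<tau> * E + 4 * \<mu>\<^sup>2 * \<tau>\<^sup>2 * s * E\<^sup>2 - \<tau> * g1"
    and "c \<equiv> 4 * n * \<mu> - 8 * \<mu> - 8 * \<mu>\<^sup>2 * s"
    and "d \<equiv> - 2 * \<mu> * \<tau> * E * (n - 2 * \<mu> * s)"
  shows "4 * (- 2 * \<mu> * \<tau> * E * (Sq - 2 * \<mu> * Z\<^sup>2)) - 2 * d * Sq + 2 * b * Sq + 2 * v * (\<tau> * \<mu> * E * c * Z)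
      + (- \<tau> * g2 + 2 * (- 2 * \<mu> * \<tau> * E * s * (4 * \<mu>\<^sup>2 * \<tau>\<^sup>2 * (2 - 4 * \<mu> * s) * E\<^sup>2 - 16 * \<mu>\<^sup>2 * \<tau> * E) + k * d) - 2 * b * k) * v\<^sup>2
    \<ge> 8 * \<mu> * \<tau> * E * Sq + (64 * \<mu>\<^sup>2 * \<tau> ^ 3 * E ^ 3 + 16 * \<mu> * \<tau>\<^sup>2 * E * g1 - \<tau> * g2 - \<tau> * E * c\<^sup>2 / 16) * v\<^sup>2"
proof -
  have "4 * (- 2 * \<mu> * \<tau> * E * (Sq - 2 * \<mu> * Z\<^sup>2)) - 2 * d * Sq + 2 * b * Sq + 2 * v * (\<tau> * \<mu> * E * c * Z)
      + (- \<tau> * g2 + 2 * (- 2 * \<mu> * \<tau> * E * s * (4 * \<mu>\<^sup>2 * \<tau>\<^sup>2 * (2 - 4 * \<mu> * s) * E\<^sup>2 - 16 * \<mu>\<^sup>2 * \<tau> * E) + k * d) - 2 * b * k) * v\<^sup>2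
    - (8 * \<mu> * \<tau> * E * Sq + (64 * \<mu>\<^sup>2 * \<tau> ^ 3 * E ^ 3 + 16 * \<mu> * \<tau>\<^sup>2 * E * g1 - \<tau> * g2 - \<tau> * E * c\<^sup>2 / 16) * v\<^sup>2)
    = \<tau> * E * (4 * \<mu> * Z + c * v / 4)\<^sup>2
      + 32 * \<mu>\<^sup>2 * \<tau> ^ 3 * E ^ 3 * (2 * (\<mu> * s) + 1) * (\<mu> * s - 2) * v\<^sup>2
      + 64 * \<mu>\<^sup>2 * \<tau>\<^sup>2 * E\<^sup>2 * (\<mu> * s - 2) * v\<^sup>2"
    unfolding b_def k_def d_def
    by (simp add: field_simps power2_eq_square power3_eq_cube)
  moreover have "0 \<le> \<tau> * E * (4 * \<mu> * Z + c * v / 4)\<^sup>2"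
    "0 \<le> 32 * \<mu>\<^sup>2 * \<tau> ^ 3 * E ^ 3 * (2 * (\<mu> * s) + 1) * (\<mu> * s - 2) * v\<^sup>2"
    "0 \<le> 64 * \<mu>\<^sup>2 * \<tau>\<^sup>2 * E\<^sup>2 * (\<mu> * s - 2) * v\<^sup>2"
    using assms by simp_all
  ultimately show ?thesis by linarith
qed


lemma carleman_estimate:
  fixes x0 :: "real^'n::finite" and g g' g'' :: "real \<Rightarrow> real"
  assumes g: "\<And>t. (g has_real_derivative g' t) (at t)" "\<And>t. (g' has_real_derivative g'' t) (at t)"
    "continuous_on UNIV g''"
    and lam: "0 < \<mu>" and K: "compact K" "\<And>p. p \<in> K \<Longrightarrow> 2 \<le> \<mu> * sqd x0 p"
  defines "\<phi> \<equiv> \<lambda>p::real \<times> (real^'n). exp (- \<mu> * sqd x0 p) - g (fst p)"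
  obtains c \<tau>0 :: real where "0 < c" "1 \<le> \<tau>0"
    "\<And>\<tau> w V W. \<tau>0 \<le> \<tau> \<Longrightarrow> C2jet UNIV w V W \<Longrightarrow> (\<And>p. p \<notin> K \<Longrightarrow> w p = 0) \<Longrightarrow>
      ennreal c * (\<integral>\<^sup>+p. ennreal (exp (2 * \<tau> * \<phi> p) * ((w p)\<^sup>2 + (\<Sum>i\<in>UNIV. (V (ex i) p)\<^sup>2))) \<partial>lborel)
      \<le> (\<integral>\<^sup>+p. ennreal (exp (2 * \<tau> * \<phi> p) * (V et p - (\<Sum>i\<in>UNIV. W (ex i) (ex i) p))\<^sup>2) \<partial>lborel)"
proof -
  define n where "n = real CARD('n)"
  define s :: "real \<times> (real^'n) \<Rightarrow> real" where "s = sqd x0"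
  define E where "E p = exp (- \<mu> * s p)" for p :: "real \<times> (real^'n)"
  define y where "y i p = (snd p - x0) $ i" for i and p :: "real \<times> (real^'n)"
  have sd: "(s has_derivative (\<lambda>e. 2 * ((snd p - x0) \<bullet> snd e))) (at p)" for p
    unfolding s_def by (rule C2jetD(1)[OF C2jet_sqd UNIV_I])
  have sc: "continuous_on UNIV s" unfolding s_def by (rule C2jetD(5)[OF C2jet_sqd])
  have Ed: "(E has_derivative (\<lambda>e. - 2 * \<mu> * ((snd p - x0) \<bullet> snd e) * E p)) (at p)" for p
    unfolding E_def by (rule derivative_eq_intros sd refl)+ (auto simp: algebra_simps)
  have Ec: "continuous_on UNIV E" unfolding E_def by (intro continuous_intros sc)
  have gd': "((\<lambda>p::real \<times> (real^'n). g' (fst p)) has_derivative (\<lambda>e. g'' (fst p) * fst e)) (at p)" for p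
    using has_derivative_compose[OF has_derivative_fst[OF has_derivative_ident] g(2)[unfolded has_field_derivative_def]] .
  have gc: "continuous_on UNIV (\<lambda>p::real \<times> (real^'n). g' (fst p))"
    using gd' by (meson continuous_at_imp_continuous_on has_derivative_continuous)
  have gc': "continuous_on UNIV (\<lambda>p::real \<times> (real^'n). g'' (fst p))"
    using continuous_on_compose2[OF g(3) continuous_on_fst[OF continuous_on_id]] by simp
  have yc: "continuous_on UNIV (y i)" for i unfolding y_def by (intro continuous_intros)
  have s_sum: "s p = (\<Sum>i\<in>UNIV. (y i p)\<^sup>2)" for p
    unfolding s_def sqd_def y_def inner_vec_def by (simp add: power2_eq_square)
  have E_pos: "0 < E p" for p by (simp add: E_def)
  have s_nonneg: "0 \<le> s p" for p by (simp add: s_def sqd_def)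
  have E_le: "E p \<le> 1" for p using lam s_nonneg[of p] by (simp add: E_def)
  obtain S where S: "0 \<le> S" "\<And>p. p \<in> K \<Longrightarrow> s p \<le> S"
    using bounded_on_compact[OF K(1) continuous_on_subset[OF sc]] by (metis abs_le_D1 subset_UNIV)
  obtain G1 where G1: "0 \<le> G1" "\<And>p. p \<in> K \<Longrightarrow> \<bar>g' (fst p)\<bar> \<le> G1"
    using bounded_on_compact[OF K(1) continuous_on_subset[OF gc]] by (metis subset_UNIV)
  obtain G2 where G2: "0 \<le> G2" "\<And>p. p \<in> K \<Longrightarrow> \<bar>g'' (fst p)\<bar> \<le> G2"
    using bounded_on_compact[OF K(1) continuous_on_subset[OF gc']] by (metis subset_UNIV)
  define c where "c p = 4 * n * \<mu> - 8 * \<mu> - 8 * \<mu>\<^sup>2 * s p" for p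
  have "continuous_on UNIV (\<lambda>p. (c p)\<^sup>2)" unfolding c_def by (intro continuous_intros sc)
  then obtain C1 where C1: "0 \<le> C1" "\<And>p. p \<in> K \<Longrightarrow> (c p)\<^sup>2 \<le> C1"
    using bounded_on_compact[OF K(1) continuous_on_subset] by (metis abs_le_D1 subset_UNIV)
  define Em where "Em = exp (- \<mu> * S)"
  have Em: "0 < Em" "\<And>p. p \<in> K \<Longrightarrow> Em \<le> E p"
    using S lam by (auto simp: Em_def E_def)
  define D where "D = 16 * \<mu> * G1 + G2 + C1 / 16"
  define c0 where "c0 = min (8 * \<mu> * Em) (32 * \<mu>\<^sup>2 * Em ^ 3)"
  define C2 where "C2 = 3 + 8 * \<mu>\<^sup>2 * S"
  define \<tau>0 where "\<tau>0 = 1 + D / (32 * \<mu>\<^sup>2 * Em ^ 3)"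
  have D: "0 \<le> D" using lam G1 G2 C1 by (simp add: D_def)
  have \<tau>0: "1 \<le> \<tau>0" using D Em lam by (simp add: \<tau>0_def)
  have c0: "0 < c0" using Em lam by (simp add: c0_def)
  have C2: "0 < C2" using S by (simp add: C2_def add_pos_nonneg)
  show ?thesis
  proof (rule that[of "c0 / C2" \<tau>0])
    fix \<tau> :: real and w V W
    assume \<tau>: "\<tau>0 \<le> \<tau>" and w: "C2jet UNIV w V W" and w0: "\<And>p. p \<notin> K \<Longrightarrow> w p = 0"
    have \<tau>1: "1 \<le> \<tau>" using \<tau> \<tau>0 by simp
    define \<Phi> where "\<Phi> p = \<tau> * (E p - g (fst p))" for p
    define \<Phi>' where "\<Phi>' e p = \<tau> * (- 2 * \<mu> * ((snd p - x0) \<bullet> snd e) * E p - g' (fst p) * fst e)" for e p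
    define \<Phi>'' where "\<Phi>'' e f p = \<tau> * ((4 * \<mu>\<^sup>2 * ((snd p - x0) \<bullet> snd e) * ((snd p - x0) \<bullet> snd f) - 2 * \<mu> * (snd e \<bullet> snd f))
        * E p - g'' (fst p) * fst e * fst f)" for e f p
    have \<Phi>: "C2jet UNIV \<Phi> \<Phi>' \<Phi>''"
      using C2jet_carleman_weight[OF g, of \<tau> \<mu> x0] unfolding \<Phi>_def \<Phi>'_def \<Phi>''_def E_def s_def .
    define v where "v p = exp (\<Phi> p) * w p" for p
    define v' where "v' e p = exp (\<Phi> p) * \<Phi>' e p * w p + exp (\<Phi> p) * V e p" for e p
    define v'' where "v'' e f p = exp (\<Phi> p) * (\<Phi>' e p * \<Phi>' f p + \<Phi>'' e f p) * w p + exp (\<Phi> p) * \<Phi>' e p * V f p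
      + exp (\<Phi> p) * \<Phi>' f p * V e p + exp (\<Phi> p) * W e f p" for e f p
    have v: "C2jet UNIV v v' v''"
      using C2jet_mult[OF C2jet_exp[OF \<Phi>] w] unfolding v_def v'_def v''_def .
    have v0: "v p = 0" if "p \<notin> K" for p using w0 that by (simp add: v_def)
    have z: "w p = 0" "V e p = 0" "W e f p = 0" "v' e p = 0" if "p \<notin> K" for e f p
      using C2jet_locally_const(1)[OF w, of "-K" 0 p e] C2jet_locally_const(2)[OF w, of "-K" 0 p e f]
        C2jet_locally_const(1)[OF v, of "-K" 0 p e] K w0 v0 that
      by (auto simp: compact_imp_closed open_Compl)
    define P where "P i p = - 2 * \<mu> * \<tau> * y i p * E p" for i p
    define P' where "P' i e p = - 2 * \<mu> * \<tau> * E p * (snd e $ i - 2 * \<mu> * y i p * ((snd p - x0) \<bullet> snd e))" for i and e p :: "real \<times> (real^'n)"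
    define b where "b p = \<tau> * (4 * \<mu>\<^sup>2 * s p - 2 * n * \<mu> + 8 * \<mu>) * E p" for p
    define b' where "b' e p = \<tau> * \<mu> * E p * c p * ((snd p - x0) \<bullet> snd e)" for e p :: "real \<times> (real^'n)"
    define k where "k p = 8 * \<mu> * \<tau> * E p + 4 * \<mu>\<^sup>2 * \<tau>\<^sup>2 * s p * (E p)\<^sup>2 - \<tau> * g' (fst p)" for p
    define k' where "k' e p = (4 * \<mu>\<^sup>2 * \<tau>\<^sup>2 * (2 - 4 * \<mu> * s p) * (E p)\<^sup>2 - 16 * \<mu>\<^sup>2 * \<tau> * E p)
        * ((snd p - x0) \<bullet> snd e) - \<tau> * g'' (fst p) * fst e" for e p :: "real \<times> (real^'n)"
    have yd: "(y i has_derivative (\<lambda>e. snd e $ i)) (at p)" for i p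
      unfolding y_def
      by (auto intro!: derivative_eq_intros bounded_linear.has_derivative[OF bounded_linear_vec_nth])
    have P: "(P i has_derivative (\<lambda>e. P' i e p)) (at p)" "continuous_on UNIV (P' i e)" for i e p
      subgoal unfolding P_def P'_def by (rule derivative_eq_intros yd Ed refl)+ (auto simp: algebra_simps)
      subgoal unfolding P'_def by (intro continuous_intros Ec yc)
      done
    have b: "(b has_derivative (\<lambda>e. b' e p)) (at p)" "continuous_on UNIV (b' e)" for e p
      subgoal unfolding b_def b'_def c_def by (rule derivative_eq_intros sd Ed refl)+ (auto simp: algebra_simps power2_eq_square)
      subgoal unfolding b'_def c_def by (intro continuous_intros Ec sc)
      done
    have k: "(k has_derivative (\<lambda>e. k' e p)) (at p)" "continuous_on UNIV (k' e)" for e p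
      subgoal unfolding k_def k'_def by (rule derivative_eq_intros sd Ed gd' refl)+ (auto simp: algebra_simps power2_eq_square)
      subgoal unfolding k'_def by (intro continuous_intros Ec sc gc')
      done
    define Sq where "Sq p = (\<Sum>i\<in>UNIV. (v' (ex i) p)\<^sup>2)" for p
    define M where "M p = v' et p + 2 * (\<Sum>i\<in>UNIV. P i p * v' (ex i) p) + b p * v p" for p
    define R where "R p = - (\<Sum>i\<in>UNIV. v'' (ex i) (ex i) p) - k p * v p" for p
    define Q where "Q p = 4 * (\<Sum>i\<in>UNIV. \<Sum>j\<in>UNIV. P' j (ex i) p * v' (ex i) p * v' (ex j) p)
        - 2 * (\<Sum>i\<in>UNIV. P' i (ex i) p) * Sq p + 2 * b p * Sq p + 2 * v p * (\<Sum>i\<in>UNIV. b' (ex i) p * v' (ex i) p)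
        + (k' et p + 2 * ((\<Sum>i\<in>UNIV. k' (ex i) p * P i p) + k p * (\<Sum>i\<in>UNIV. P' i (ex i) p)) - 2 * b p * k p) * (v p)\<^sup>2" for p
    have id: "integrable lborel (\<lambda>p. 2 * M p * R p)" "integrable lborel Q"
      "(\<integral>p. 2 * M p * R p \<partial>lborel) = (\<integral>p. Q p \<partial>lborel)"
      unfolding M_def R_def Q_def Sq_def
      by (rule carleman_integral_identity[where P = P and P' = P' and b = b and b' = b' and k = k and k' = k',
          OF v K(1) v0 P b k]; assumption)+
    have ax: "(snd p - x0) \<bullet> axis i 1 = y i p" for p i by (simp add: y_def inner_axis)
    have F: "M p + R p = exp (\<Phi> p) * (V et p - (\<Sum>i\<in>UNIV. W (ex i) (ex i) p))" for p
    proof -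
      have P\<Phi>: "P i p = \<Phi>' (ex i) p" for i
        by (simp add: P_def \<Phi>'_def ax)
      have 1: "(\<Sum>i\<in>UNIV. \<Phi>'' (ex i) (ex i) p) = \<tau> * (4 * \<mu>\<^sup>2 * s p - 2 * \<mu> * n) * E p"
        unfolding \<Phi>''_def s_sum n_def snd_conv fst_conv ax
        by (simp add: sum.distrib sum_negf sum_subtractf sum_distrib_left sum_distrib_right algebra_simps power2_eq_square inner_axis_axis)
      have 2: "(\<Sum>i\<in>UNIV. (\<Phi>' (ex i) p)\<^sup>2) = 4 * \<mu>\<^sup>2 * \<tau>\<^sup>2 * s p * (E p)\<^sup>2"
        unfolding \<Phi>'_def s_sum snd_conv fst_conv ax
        by (simp add: sum_distrib_left sum_distrib_right algebra_simps power2_eq_square)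
      have 3: "\<Phi>' et p = - \<tau> * g' (fst p)" by (simp add: \<Phi>'_def)
      have "k p = b p - (\<Sum>i\<in>UNIV. \<Phi>'' (ex i) (ex i) p) + (\<Sum>i\<in>UNIV. (\<Phi>' (ex i) p)\<^sup>2) + \<Phi>' et p"
        unfolding 1 2 3 k_def b_def by (simp add: algebra_simps)
      thus ?thesis
        unfolding M_def R_def P\<Phi> v_def v'_def v''_def by (rule conjugated_heat_operator)
    qed
    have Q_eq: "Q p = 4 * (- 2 * \<mu> * \<tau> * E p * (Sq p - 2 * \<mu> * (\<Sum>i\<in>UNIV. y i p * v' (ex i) p)\<^sup>2))
      - 2 * (- 2 * \<mu> * \<tau> * E p * (n - 2 * \<mu> * s p)) * Sq p + 2 * b p * Sq p
      + 2 * v p * (\<tau> * \<mu> * E p * c p * (\<Sum>i\<in>UNIV. y i p * v' (ex i) p))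
      + (- \<tau> * g'' (fst p) + 2 * (- 2 * \<mu> * \<tau> * E p * s p * (4 * \<mu>\<^sup>2 * \<tau>\<^sup>2 * (2 - 4 * \<mu> * s p) * (E p)\<^sup>2 - 16 * \<mu>\<^sup>2 * \<tau> * E p)
          + k p * (- 2 * \<mu> * \<tau> * E p * (n - 2 * \<mu> * s p))) - 2 * b p * k p) * (v p)\<^sup>2" for p
    proof -
      define Z where "Z = (\<Sum>i\<in>UNIV. y i p * v' (ex i) p)"
      have P'ij: "P' j (ex i) p = - 2 * \<mu> * \<tau> * E p * ((if i = j then 1 else 0) - 2 * \<mu> * y j p * y i p)" for i j
        by (simp add: P'_def ax) (simp add: axis_def)
      have "(\<Sum>i\<in>UNIV. \<Sum>j\<in>UNIV. P' j (ex i) p * v' (ex i) p * v' (ex j) p)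
        = - 2 * \<mu> * \<tau> * E p * ((\<Sum>i\<in>UNIV. \<Sum>j\<in>UNIV. (if i = j then 1 else 0) * v' (ex i) p * v' (ex j) p)
           - 2 * \<mu> * (\<Sum>i\<in>UNIV. \<Sum>j\<in>UNIV. (y i p * v' (ex i) p) * (y j p * v' (ex j) p)))"
        unfolding P'ij by (simp add: sum_subtractf sum_negf sum_distrib_left algebra_simps)
      also have "(\<Sum>i\<in>UNIV. \<Sum>j\<in>UNIV. (if i = j then 1 else 0) * v' (ex i) p * v' (ex j) p) = Sq p"
        unfolding Sq_def by (simp add: if_distrib[of "\<lambda>x. x * _"] power2_eq_square cong: if_cong)
      also have "(\<Sum>i\<in>UNIV. \<Sum>j\<in>UNIV. (y i p * v' (ex i) p) * (y j p * v' (ex j) p)) = Z\<^sup>2"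
        unfolding Z_def power2_eq_square by (simp add: sum_product)
      finally have 1: "(\<Sum>i\<in>UNIV. \<Sum>j\<in>UNIV. P' j (ex i) p * v' (ex i) p * v' (ex j) p)
        = - 2 * \<mu> * \<tau> * E p * (Sq p - 2 * \<mu> * Z\<^sup>2)" .
      have 2: "(\<Sum>i\<in>UNIV. P' i (ex i) p) = - 2 * \<mu> * \<tau> * E p * (n - 2 * \<mu> * s p)"
        unfolding P'ij s_sum n_def
        by (simp add: sum_subtractf sum_negf sum_distrib_left algebra_simps power2_eq_square)
      have 3: "(\<Sum>i\<in>UNIV. b' (ex i) p * v' (ex i) p) = \<tau> * \<mu> * E p * c p * Z"
        unfolding Z_def b'_def snd_conv fst_conv ax by (simp add: sum_distrib_left algebra_simps)
      have 4: "(\<Sum>i\<in>UNIV. k' (ex i) p * P i p) = - 2 * \<mu> * \<tau> * E p * s p * (4 * \<mu>\<^sup>2 * \<tau>\<^sup>2 * (2 - 4 * \<mu> * s p) * (E p)\<^sup>2 - 16 * \<mu>\<^sup>2 * \<tau> * E p)"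
      proof -
        define B where "B = 4 * \<mu>\<^sup>2 * \<tau>\<^sup>2 * (2 - 4 * \<mu> * s p) * (E p)\<^sup>2 - 16 * \<mu>\<^sup>2 * \<tau> * E p"
        have "k' (ex i) p = B * y i p" for i unfolding k'_def B_def snd_conv fst_conv ax by simp
        hence "(\<Sum>i\<in>UNIV. k' (ex i) p * P i p) = - 2 * \<mu> * \<tau> * E p * (\<Sum>i\<in>UNIV. (y i p)\<^sup>2) * B"
          unfolding P_def by (simp add: sum_negf sum_distrib_left sum_distrib_right algebra_simps power2_eq_square)
        thus ?thesis unfolding B_def s_sum[symmetric] .
      qed
      have 5: "k' et p = - \<tau> * g'' (fst p)" by (simp add: k'_def)
      show ?thesis unfolding Q_def 1 2 3 4 5 Z_def ..
    qed
    have Q_ge: "c0 * (\<tau> * Sq p + \<tau> ^ 3 * (v p)\<^sup>2) \<le> Q p" if p: "p \<in> K" for p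
    proof -
      have "8 * \<mu> * \<tau> * E p * Sq p + (64 * \<mu>\<^sup>2 * \<tau> ^ 3 * (E p) ^ 3 + 16 * \<mu> * \<tau>\<^sup>2 * E p * g' (fst p)
          - \<tau> * g'' (fst p) - \<tau> * E p * (c p)\<^sup>2 / 16) * (v p)\<^sup>2 \<le> Q p"
        unfolding Q_eq b_def k_def c_def
        by (rule carleman_quadratic_form_lower_bound) (use lam \<tau>1 E_pos K(2)[OF p] in \<open>auto simp: s_def\<close>)
      moreover have "c0 * \<tau> * Sq p \<le> 8 * \<mu> * \<tau> * E p * Sq p"
      proof (rule mult_right_mono)
        have "c0 * \<tau> \<le> (8 * \<mu> * Em) * \<tau>" using \<tau>1 by (intro mult_right_mono) (auto simp: c0_def)
        also have "\<dots> \<le> (8 * \<mu> * E p) * \<tau>" using \<tau>1 lam Em(2)[OF p] by (intro mult_right_mono mult_left_mono) auto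
        finally show "c0 * \<tau> \<le> 8 * \<mu> * \<tau> * E p" by (simp add: mult_ac)
      qed (simp add: Sq_def sum_nonneg)
      moreover have "c0 * \<tau> ^ 3 * (v p)\<^sup>2 \<le> (64 * \<mu>\<^sup>2 * \<tau> ^ 3 * (E p) ^ 3 + 16 * \<mu> * \<tau>\<^sup>2 * E p * g' (fst p)
          - \<tau> * g'' (fst p) - \<tau> * E p * (c p)\<^sup>2 / 16) * (v p)\<^sup>2"
      proof (rule mult_right_mono)
        have "D \<le> 32 * \<mu>\<^sup>2 * Em ^ 3 * \<tau>"
        proof -
          define X where "X = 32 * \<mu>\<^sup>2 * Em ^ 3"
          have X: "0 < X" using Em lam by (simp add: X_def)
          have "D / X \<le> \<tau>" using \<tau> unfolding \<tau>0_def X_def by simp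
          hence "D \<le> X * \<tau>" using X by (simp add: field_simps)
          thus ?thesis unfolding X_def .
        qed
        hence "\<tau>\<^sup>2 * D \<le> \<tau>\<^sup>2 * (32 * \<mu>\<^sup>2 * Em ^ 3 * \<tau>)" by (intro mult_left_mono) auto
        hence 1: "\<tau>\<^sup>2 * D \<le> 32 * \<mu>\<^sup>2 * Em ^ 3 * \<tau> ^ 3" by (simp add: power2_eq_square power3_eq_cube mult_ac)
        have 2: "64 * \<mu>\<^sup>2 * Em ^ 3 * \<tau> ^ 3 \<le> 64 * \<mu>\<^sup>2 * \<tau> ^ 3 * (E p) ^ 3"
        proof -
          have "Em ^ 3 \<le> (E p) ^ 3" using Em(1) Em(2)[OF p] by (intro power_mono) auto
          hence "64 * \<mu>\<^sup>2 * \<tau> ^ 3 * Em ^ 3 \<le> 64 * \<mu>\<^sup>2 * \<tau> ^ 3 * (E p) ^ 3" using \<tau>1 by (intro mult_left_mono) auto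
          thus ?thesis by (simp add: mult_ac)
        qed
        have E1: "E p * a \<le> a" if "0 \<le> a" for a using mult_right_mono[OF E_le that] by simp
        have 3: "16 * \<mu> * \<tau>\<^sup>2 * E p * g' (fst p) \<ge> - \<tau>\<^sup>2 * (16 * \<mu> * G1)"
        proof -
          have "E p * (- g' (fst p)) \<le> E p * G1" using G1(2)[OF p] E_pos[of p] by (intro mult_left_mono) auto
          also have "\<dots> \<le> G1" using G1 E1 by blast
          finally have "(16 * \<mu> * \<tau>\<^sup>2) * (E p * (- g' (fst p))) \<le> (16 * \<mu> * \<tau>\<^sup>2) * G1"
            using lam by (intro mult_left_mono) auto
          thus ?thesis by (simp add: mult_ac)
        qed
        have tt: "\<tau> * a \<le> \<tau>\<^sup>2 * a" if "0 \<le> a" for a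
          using that \<tau>1 by (simp add: mult_right_mono power2_eq_square)
        have 4: "\<tau> * g'' (fst p) \<le> \<tau>\<^sup>2 * G2"
        proof -
          have "\<tau> * g'' (fst p) \<le> \<tau> * G2" using G2(2)[OF p] \<tau>1 by (intro mult_left_mono) auto
          also have "\<dots> \<le> \<tau>\<^sup>2 * G2" by (rule tt) (rule G2)
          finally show ?thesis .
        qed
        have 5: "\<tau> * E p * (c p)\<^sup>2 / 16 \<le> \<tau>\<^sup>2 * (C1 / 16)"
        proof -
          have "E p * (c p)\<^sup>2 \<le> C1" using E1[of "(c p)\<^sup>2"] C1(2)[OF p] by simp
          hence "\<tau> * (E p * (c p)\<^sup>2) \<le> \<tau> * C1" using \<tau>1 by (intro mult_left_mono) auto
          also have "\<dots> \<le> \<tau>\<^sup>2 * C1" by (rule tt) (rule C1)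
          finally show ?thesis by (simp add: mult_ac)
        qed
        have "\<tau>\<^sup>2 * D = \<tau>\<^sup>2 * (16 * \<mu> * G1) + \<tau>\<^sup>2 * G2 + \<tau>\<^sup>2 * (C1 / 16)"
          by (simp add: D_def algebra_simps)
        moreover have "c0 * \<tau> ^ 3 \<le> 32 * \<mu>\<^sup>2 * Em ^ 3 * \<tau> ^ 3"
          using \<tau>1 by (intro mult_right_mono) (auto simp: c0_def)
        ultimately show "c0 * \<tau> ^ 3 \<le> 64 * \<mu>\<^sup>2 * \<tau> ^ 3 * (E p) ^ 3 + 16 * \<mu> * \<tau>\<^sup>2 * E p * g' (fst p)
          - \<tau> * g'' (fst p) - \<tau> * E p * (c p)\<^sup>2 / 16"
          using 1 2 3 4 5 by linarith
      qed simp
      ultimately show ?thesis by (simp add: algebra_simps)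
    qed
    define N where "N p = exp (2 * \<tau> * \<phi> p) * ((w p)\<^sup>2 + (\<Sum>i\<in>UNIV. (V (ex i) p)\<^sup>2))" for p
    have exp2: "exp (2 * \<tau> * \<phi> p) = (exp (\<Phi> p))\<^sup>2" for p
      by (simp add: \<phi>_def \<Phi>_def E_def s_def power2_eq_square exp_add[symmetric])
    have N_le: "N p \<le> C2 * (\<tau> * Sq p + \<tau> ^ 3 * (v p)\<^sup>2)" if p: "p \<in> K" for p
    proof -
      have "(exp (\<Phi> p) * V (ex i) p)\<^sup>2 \<le> 2 * (v' (ex i) p)\<^sup>2 + 2 * (\<Phi>' (ex i) p)\<^sup>2 * (v p)\<^sup>2" for i
      proof -
        have "exp (\<Phi> p) * V (ex i) p = v' (ex i) p - \<Phi>' (ex i) p * v p" by (simp add: v'_def v_def)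
        hence "(exp (\<Phi> p) * V (ex i) p)\<^sup>2 = 2 * (v' (ex i) p)\<^sup>2 + 2 * (\<Phi>' (ex i) p * v p)\<^sup>2
            - (v' (ex i) p + \<Phi>' (ex i) p * v p)\<^sup>2"
          by (simp only:) (simp add: power2_eq_square algebra_simps)
        thus ?thesis by (simp add: power_mult_distrib)
      qed
      hence "(\<Sum>i\<in>UNIV. (exp (\<Phi> p) * V (ex i) p)\<^sup>2)
        \<le> (\<Sum>i\<in>UNIV. 2 * (v' (ex i) p)\<^sup>2 + 2 * (\<Phi>' (ex i) p)\<^sup>2 * (v p)\<^sup>2)"
        by (rule sum_mono)
      also have "\<dots> = 2 * Sq p + 2 * (4 * \<mu>\<^sup>2 * \<tau>\<^sup>2 * s p * (E p)\<^sup>2) * (v p)\<^sup>2"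
        unfolding Sq_def s_sum \<Phi>'_def snd_conv fst_conv ax
        by (simp add: sum.distrib sum_negf sum_distrib_left sum_distrib_right algebra_simps power2_eq_square)
      also have "\<dots> \<le> 2 * Sq p + 2 * (4 * \<mu>\<^sup>2 * \<tau>\<^sup>2 * S * 1) * (v p)\<^sup>2"
        using S(1) S(2)[OF p] E_pos[of p] E_le[of p] s_nonneg[of p]
        by (intro add_left_mono mult_right_mono mult_left_mono mult_mono power_le_one) auto
      finally have 1: "(\<Sum>i\<in>UNIV. (exp (\<Phi> p) * V (ex i) p)\<^sup>2) \<le> 2 * Sq p + 8 * \<mu>\<^sup>2 * S * \<tau>\<^sup>2 * (v p)\<^sup>2"
        by (simp add: mult_ac)
      have "N p = (v p)\<^sup>2 + (\<Sum>i\<in>UNIV. (exp (\<Phi> p) * V (ex i) p)\<^sup>2)"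
        unfolding N_def exp2 v_def by (simp add: sum_distrib_left power_mult_distrib algebra_simps)
      also have "\<dots> \<le> 2 * Sq p + ((v p)\<^sup>2 + 8 * \<mu>\<^sup>2 * S * \<tau>\<^sup>2 * (v p)\<^sup>2)" using 1 by simp
      also have "\<dots> \<le> C2 * (\<tau> * Sq p) + C2 * (\<tau> ^ 3 * (v p)\<^sup>2)"
      proof (rule add_mono)
        have "0 \<le> Sq p" by (simp add: Sq_def sum_nonneg)
        hence "2 * Sq p \<le> C2 * Sq p" using S by (intro mult_right_mono) (auto simp: C2_def)
        also have "\<dots> \<le> C2 * (\<tau> * Sq p)"
          using C2 \<tau>1 \<open>0 \<le> Sq p\<close> mult_right_mono[of 1 \<tau> "Sq p"] by (intro mult_left_mono) auto
        finally show "2 * Sq p \<le> C2 * (\<tau> * Sq p)" .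
        have t2: "\<tau>\<^sup>2 \<le> \<tau> ^ 3" using \<tau>1 by (intro power_increasing) auto
        moreover have "1 \<le> \<tau> ^ 3" using \<tau>1 by simp
        ultimately have "1 + 8 * \<mu>\<^sup>2 * S * \<tau>\<^sup>2 \<le> 3 * \<tau> ^ 3 + 8 * \<mu>\<^sup>2 * S * \<tau> ^ 3"
          using S(1) by (intro add_mono mult_left_mono) auto
        hence "(1 + 8 * \<mu>\<^sup>2 * S * \<tau>\<^sup>2) * (v p)\<^sup>2 \<le> (3 * \<tau> ^ 3 + 8 * \<mu>\<^sup>2 * S * \<tau> ^ 3) * (v p)\<^sup>2"
          by (intro mult_right_mono) auto
        thus "(v p)\<^sup>2 + 8 * \<mu>\<^sup>2 * S * \<tau>\<^sup>2 * (v p)\<^sup>2 \<le> C2 * (\<tau> ^ 3 * (v p)\<^sup>2)"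
          by (simp add: C2_def algebra_simps)
      qed
      finally show ?thesis by (simp add: algebra_simps)
    qed
    have \<Phi>c: "continuous_on UNIV (\<lambda>p. exp (2 * \<tau> * \<phi> p))"
      unfolding exp2 by (intro continuous_intros C2jetD(5)[OF \<Phi>])
    have iN: "integrable lborel N"
      unfolding N_def
      by (rule integrable_continuous_compact_support[OF _ K(1)])
        (auto simp: z intro!: continuous_intros \<Phi>c C2jetD(4,5)[OF w])
    define H where "H p = exp (2 * \<tau> * \<phi> p) * (V et p - (\<Sum>i\<in>UNIV. W (ex i) (ex i) p))\<^sup>2" for p
    have iH: "integrable lborel H"
      unfolding H_def
      by (rule integrable_continuous_compact_support[OF _ K(1)])
        (auto simp: z intro!: continuous_intros \<Phi>c C2jetD(3,4,5)[OF w])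
    have NQ: "c0 / C2 * N p \<le> Q p" for p
    proof (cases "p \<in> K")
      case True
      have "c0 / C2 * N p \<le> c0 / C2 * (C2 * (\<tau> * Sq p + \<tau> ^ 3 * (v p)\<^sup>2))"
        using c0 C2 N_le[OF True] by (intro mult_left_mono) auto
      also have "\<dots> = c0 * (\<tau> * Sq p + \<tau> ^ 3 * (v p)\<^sup>2)" using C2 by simp
      also have "\<dots> \<le> Q p" by (rule Q_ge[OF True])
      finally show ?thesis .
    next
      case False
      thus ?thesis by (simp add: N_def Q_def Sq_def z v0)
    qed
    have MRH: "2 * M p * R p \<le> H p" for p
    proof -
      have "0 \<le> (M p)\<^sup>2 + (R p)\<^sup>2" by simp
      hence "2 * M p * R p \<le> (M p + R p)\<^sup>2" by (simp add: power2_eq_square algebra_simps)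
      thus ?thesis unfolding F H_def exp2 by (simp add: power_mult_distrib)
    qed
    have "c0 / C2 * (\<integral>p. N p \<partial>lborel) = (\<integral>p. c0 / C2 * N p \<partial>lborel)" by simp
    also have "\<dots> \<le> (\<integral>p. Q p \<partial>lborel)"
      using iN id NQ by (intro integral_mono) auto
    also have "\<dots> = (\<integral>p. 2 * M p * R p \<partial>lborel)" using id by simp
    also have "\<dots> \<le> (\<integral>p. H p \<partial>lborel)"
      using iH id MRH by (intro integral_mono) auto
    finally have le: "c0 / C2 * (\<integral>p. N p \<partial>lborel) \<le> (\<integral>p. H p \<partial>lborel)" .
    have N0: "0 \<le> N p" and H0: "0 \<le> H p" for p by (simp_all add: N_def H_def sum_nonneg)
    have "ennreal (c0 / C2) * (\<integral>\<^sup>+p. ennreal (N p) \<partial>lborel) = ennreal (c0 / C2 * (\<integral>p. N p \<partial>lborel))"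
      using c0 C2 N0 by (subst ennreal_mult) (simp_all add: nn_integral_eq_integral[OF iN])
    also have "\<dots> \<le> (\<integral>\<^sup>+p. ennreal (H p) \<partial>lborel)"
      using le H0 by (simp add: nn_integral_eq_integral[OF iH] ennreal_leI)
    finally show "ennreal (c0 / C2) * (\<integral>\<^sup>+p. ennreal (exp (2 * \<tau> * \<phi> p) * ((w p)\<^sup>2 + (\<Sum>i\<in>UNIV. (V (ex i) p)\<^sup>2))) \<partial>lborel)
      \<le> (\<integral>\<^sup>+p. ennreal (exp (2 * \<tau> * \<phi> p) * (V et p - (\<Sum>i\<in>UNIV. W (ex i) (ex i) p))\<^sup>2) \<partial>lborel)"
      unfolding N_def H_def .
  qed (use c0 C2 \<tau>0 in auto)
qed

section \<open>Cutoff functions\<close>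

lemma has_real_derivative_max_power:
  "((\<lambda>z::real. max 0 z ^ Suc (Suc m)) has_real_derivative real (Suc (Suc m)) * max 0 z ^ Suc m) (at z)"
proof -
  consider "z < 0" | "z > 0" | "z = 0" by linarith
  thus ?thesis
  proof cases
    case 1
    have "((\<lambda>z::real. 0) has_real_derivative 0) (at z)" by simp
    hence "((\<lambda>z::real. max 0 z ^ Suc (Suc m)) has_real_derivative 0) (at z)"
      by (rule has_field_derivative_transform_within_open[of _ _ _ "{..<0}"]) (use 1 in auto)
    thus ?thesis using 1 by simp
  next
    case 2
    have "((\<lambda>z::real. z ^ Suc (Suc m)) has_real_derivative real (Suc (Suc m)) * z ^ Suc m) (at z)"
      using DERIV_pow[of "Suc (Suc m)" z] by simp
    hence "((\<lambda>z::real. max 0 z ^ Suc (Suc m)) has_real_derivative real (Suc (Suc m)) * z ^ Suc m) (at z)"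
      by (rule has_field_derivative_transform_within_open[of _ _ _ "{0<..}"]) (use 2 in auto)
    thus ?thesis using 2 by simp
  next
    case 3
    have "((\<lambda>h::real. max 0 h ^ Suc (Suc m) / h) \<longlongrightarrow> 0) (at 0)"
    proof (rule Lim_null_comparison)
      show "\<forall>\<^sub>F h::real in at 0. norm (max 0 h ^ Suc (Suc m) / h) \<le> \<bar>h\<bar> ^ Suc m"
      proof (intro always_eventually allI)
        fix h :: real
        show "norm (max 0 h ^ Suc (Suc m) / h) \<le> \<bar>h\<bar> ^ Suc m"
          by (cases h "0::real" rule: linorder_cases) (auto simp: max_def mult_nonpos_nonneg)
      qed
      show "((\<lambda>h::real. \<bar>h\<bar> ^ Suc m) \<longlongrightarrow> 0) (at 0)"
        by (auto intro!: tendsto_eq_intros)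
    qed
    thus ?thesis using 3 by (simp add: DERIV_def)
  qed
qed

text \<open>The step function is the third difference of the truncated cubic, i.e. an integrated B-spline.\<close>
lemma C2_step_function:
  obtains f f' f'' :: "real \<Rightarrow> real" where
    "\<And>z. (f has_real_derivative f' z) (at z)" "\<And>z. (f' has_real_derivative f'' z) (at z)"
    "continuous_on UNIV f''" "\<And>z. z \<le> 0 \<Longrightarrow> f z = 0" "\<And>z. 3 \<le> z \<Longrightarrow> f z = 1"
proof -
  define D where "D p z = p z - 3 * p (z - 1) + 3 * p (z - 2) - p (z - 3)" for p :: "real \<Rightarrow> real" and z
  define q where "q m z = max 0 z ^ Suc m" for m and z :: real
  have q: "(q (Suc m) has_real_derivative real (Suc (Suc m)) * q m z) (at z)" for m z
    unfolding q_def by (rule has_real_derivative_max_power)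
  have q': "((\<lambda>z. q (Suc m) (z - a)) has_real_derivative real (Suc (Suc m)) * q m (z - a)) (at z)" for m z a
  proof -
    have "((\<lambda>z. z - a) has_real_derivative 1) (at z)" by (auto intro!: derivative_eq_intros)
    from DERIV_chain2[OF q this] show ?thesis by simp
  qed
  show ?thesis
  proof (rule that[of "\<lambda>z. D (q 2) z / 6" "\<lambda>z. D (q 1) z / 2" "D (q 0)"])
    have q2: "((\<lambda>z. q 2 (z - a)) has_real_derivative 3 * q 1 (z - a)) (at z)" for z a
      using q'[of 1 a z] by (simp add: numeral_2_eq_2)
    have q1: "((\<lambda>z. q 1 (z - a)) has_real_derivative 2 * q 0 (z - a)) (at z)" for z a
      using q'[of 0 a z] by simp
    have D2: "(D (q 2) has_real_derivative 3 * q 1 z - 3 * (3 * q 1 (z - 1)) + 3 * (3 * q 1 (z - 2)) - 3 * q 1 (z - 3)) (at z)" for z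
      unfolding D_def
      by (intro DERIV_diff DERIV_add DERIV_cmult q2 q2[of 0, unfolded diff_zero])
    have "3 * q 1 z - 3 * (3 * q 1 (z - 1)) + 3 * (3 * q 1 (z - 2)) - 3 * q 1 (z - 3) = 3 * D (q 1) z" for z
      by (simp add: D_def)
    from DERIV_cdivide[OF D2[unfolded this], where c = 6]
    show "((\<lambda>z. D (q 2) z / 6) has_real_derivative D (q 1) z / 2) (at z)" for z
      by simp
    have D1: "(D (q 1) has_real_derivative 2 * q 0 z - 3 * (2 * q 0 (z - 1)) + 3 * (2 * q 0 (z - 2)) - 2 * q 0 (z - 3)) (at z)" for z
      unfolding D_def
      by (intro DERIV_diff DERIV_add DERIV_cmult q1 q1[of 0, unfolded diff_zero])
    have "2 * q 0 z - 3 * (2 * q 0 (z - 1)) + 3 * (2 * q 0 (z - 2)) - 2 * q 0 (z - 3) = 2 * D (q 0) z" for z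
      by (simp add: D_def)
    from DERIV_cdivide[OF D1[unfolded this], where c = 2]
    show "((\<lambda>z. D (q 1) z / 2) has_real_derivative D (q 0) z) (at z)" for z
      by simp
    show "continuous_on UNIV (D (q 0))"
      unfolding D_def q_def by (intro continuous_intros)
    show "D (q 2) z / 6 = 0" if "z \<le> 0" for z using that by (simp add: D_def q_def)
    show "D (q 2) z / 6 = 1" if "3 \<le> z" for z
      using that by (simp add: D_def q_def max_def eval_nat_numeral) (simp add: algebra_simps)
  qed
qed

lemma C2_cutoff:
  fixes a b c d :: real
  assumes "a < b" "b < c" "c < d"
  obtains f f' f'' :: "real \<Rightarrow> real" where
    "\<And>z. (f has_real_derivative f' z) (at z)" "\<And>z. (f' has_real_derivative f'' z) (at z)"
    "continuous_on UNIV f''" "\<And>z. z \<le> a \<or> d \<le> z \<Longrightarrow> f z = 0" "\<And>z. b \<le> z \<Longrightarrow> z \<le> c \<Longrightarrow> f z = 1"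
proof -
  obtain h h' h'' :: "real \<Rightarrow> real" where h:
    "\<And>z. (h has_real_derivative h' z) (at z)" "\<And>z. (h' has_real_derivative h'' z) (at z)"
    "continuous_on UNIV h''" "\<And>z. z \<le> 0 \<Longrightarrow> h z = 0" "\<And>z. 3 \<le> z \<Longrightarrow> h z = 1"
    using C2_step_function by metis
  define \<alpha> where "\<alpha> = 3 / (b - a)"
  define \<beta> where "\<beta> = 3 / (d - c)"
  define m where "m z = \<alpha> * (z - a)" for z
  define l where "l z = \<beta> * (d - z)" for z
  have m: "((\<lambda>z. k (m z)) has_real_derivative \<alpha> * k' (m z)) (at z)"
    if "\<And>z. (k has_real_derivative k' z) (at z)" for k k' z
  proof -
    have "(m has_real_derivative \<alpha>) (at z)" unfolding m_def by (auto intro!: derivative_eq_intros)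
    from DERIV_chain2[OF that this] show ?thesis by (simp add: mult.commute)
  qed
  have l: "((\<lambda>z. k (l z)) has_real_derivative - \<beta> * k' (l z)) (at z)"
    if "\<And>z. (k has_real_derivative k' z) (at z)" for k k' z
  proof -
    have "(l has_real_derivative - \<beta>) (at z)" unfolding l_def by (auto intro!: derivative_eq_intros)
    from DERIV_chain2[OF that this] show ?thesis by (simp add: mult.commute)
  qed
  have c': "continuous_on UNIV h" "continuous_on UNIV h'"
    using h(1,2) by (auto intro!: continuous_at_imp_continuous_on intro: DERIV_isCont)
  have mc: "continuous_on UNIV m" unfolding m_def by (intro continuous_intros)
  have lc: "continuous_on UNIV l" unfolding l_def by (intro continuous_intros)
  have cc: "continuous_on UNIV (\<lambda>z. k (m z))" "continuous_on UNIV (\<lambda>z. k (l z))"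
    if "continuous_on UNIV k" for k :: "real \<Rightarrow> real"
    using continuous_on_compose2[OF that mc] continuous_on_compose2[OF that lc] by auto
  show ?thesis
  proof (rule that[of "\<lambda>z. h (m z) * h (l z)" "\<lambda>z. \<alpha> * h' (m z) * h (l z) - \<beta> * h (m z) * h' (l z)"
        "\<lambda>z. \<alpha>\<^sup>2 * h'' (m z) * h (l z) - 2 * \<alpha> * \<beta> * h' (m z) * h' (l z) + \<beta>\<^sup>2 * h (m z) * h'' (l z)"])
    show "((\<lambda>z. h (m z) * h (l z)) has_real_derivative
        \<alpha> * h' (m z) * h (l z) - \<beta> * h (m z) * h' (l z)) (at z)" for z
      by (rule derivative_eq_intros m[OF h(1)] l[OF h(1)] refl)+ (simp add: algebra_simps)
    show "((\<lambda>z. \<alpha> * h' (m z) * h (l z) - \<beta> * h (m z) * h' (l z)) has_real_derivative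
       \<alpha>\<^sup>2 * h'' (m z) * h (l z) - 2 * \<alpha> * \<beta> * h' (m z) * h' (l z) + \<beta>\<^sup>2 * h (m z) * h'' (l z)) (at z)" for z
      by (rule derivative_eq_intros m[OF h(1)] l[OF h(1)] m[OF h(2)] l[OF h(2)] refl)+
        (simp add: algebra_simps power2_eq_square)
    show "continuous_on UNIV (\<lambda>z. \<alpha>\<^sup>2 * h'' (m z) * h (l z) - 2 * \<alpha> * \<beta> * h' (m z) * h' (l z)
        + \<beta>\<^sup>2 * h (m z) * h'' (l z))"
      by (intro continuous_intros cc c' h(3))
    show "h (m z) * h (l z) = 0" if "z \<le> a \<or> d \<le> z" for z
    proof -
      have "m z \<le> 0 \<or> l z \<le> 0"
        using that assms unfolding m_def l_def \<alpha>_def \<beta>_def by (auto simp: divide_simps)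
      thus ?thesis using h(4) by auto
    qed
    show "h (m z) * h (l z) = 1" if "b \<le> z" "z \<le> c" for z
    proof -
      have "3 \<le> m z" "3 \<le> l z"
        using that assms unfolding m_def l_def \<alpha>_def \<beta>_def by (auto simp: divide_simps)
      thus ?thesis using h(5) by auto
    qed
  qed
qed

section \<open>The three cylinder inequality\<close>

lemma interpolation_optimisation:
  fixes a X Y C p q \<tau>0 :: real
  assumes "0 \<le> X" "0 \<le> Y" "a \<le> Y" "0 < C" "0 < p" "0 < q"
    and le: "\<And>\<tau>. \<tau>0 \<le> \<tau> \<Longrightarrow> a \<le> C * (exp (p * \<tau>) * X + exp (- q * \<tau>) * Y)"
  shows "a \<le> (2 * C + exp (q * \<tau>0)) * (X powr (q / (p + q)) * Y powr (1 - q / (p + q)))"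
proof (cases "X = 0 \<or> Y = 0")
  case True
  have "a \<le> 0"
  proof (cases "Y = 0")
    case False
    hence X: "X = 0" using True by simp
    have "((\<lambda>\<tau>. C * (exp (- q * \<tau>) * Y)) \<longlongrightarrow> C * (0 * Y)) at_top"
      using \<open>0 < q\<close>
      by (intro tendsto_intros filterlim_compose[OF exp_at_bot]
          filterlim_tendsto_neg_mult_at_bot[OF tendsto_const _ filterlim_ident]) auto
    moreover have "\<forall>\<^sub>F \<tau> in at_top. a \<le> C * (exp (- q * \<tau>) * Y)"
      using le X by (intro eventually_mono[OF eventually_ge_at_top[of \<tau>0]]) auto
    ultimately show ?thesis
      using tendsto_lowerbound[of "\<lambda>\<tau>. C * (exp (- q * \<tau>) * Y)" "C * (0 * Y)" at_top a] by simp
  qed (use assms in simp)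
  thus ?thesis using assms by (smt (verit) exp_gt_zero mult_nonneg_nonneg powr_ge_zero)
next
  case False
  hence XY: "0 < X" "0 < Y" using assms by auto
  define \<tau> where "\<tau> = ln (Y / X) / (p + q)"
  define Z where "Z = X powr (q / (p + q)) * Y powr (1 - q / (p + q))"
  have pq: "0 < p + q" using assms by simp
  have Z: "Z = exp (q / (p + q) * ln X + p / (p + q) * ln Y)"
  proof -
    have "1 - q / (p + q) = p / (p + q)" using pq by (simp add: field_simps)
    thus ?thesis using XY unfolding Z_def by (simp add: powr_def exp_add)
  qed
  have lnYX: "ln (Y / X) = ln Y - ln X" using XY by (simp add: ln_div)
  have p\<tau>: "p * \<tau> = p / (p + q) * (ln Y - ln X)" and q\<tau>: "- q * \<tau> = - (q / (p + q)) * (ln Y - ln X)"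
    by (simp_all add: \<tau>_def lnYX)
  have sum1: "p / (p + q) + q / (p + q) = 1" using pq by (simp add: add_divide_distrib[symmetric])
  have 1: "exp (p * \<tau>) * X = Z"
  proof -
    have "exp (p * \<tau>) * X = exp (p * \<tau> + ln X)" using XY by (simp add: exp_add)
    also have "p * \<tau> + ln X = q / (p + q) * ln X + p / (p + q) * ln Y"
      unfolding p\<tau> using sum1 by algebra
    finally show ?thesis using Z by simp
  qed
  have 2: "exp (- q * \<tau>) * Y = Z"
  proof -
    have "exp (- q * \<tau>) * Y = exp (- q * \<tau> + ln Y)" using XY by (simp only: exp_add exp_ln)
    also have "- q * \<tau> + ln Y = q / (p + q) * ln X + p / (p + q) * ln Y"
      unfolding q\<tau> using sum1 by algebra
    finally show ?thesis using Z by simp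
  qed
  have Z0: "0 < Z" using Z by simp
  show ?thesis
  proof (cases "\<tau>0 \<le> \<tau>")
    case True
    have "a \<le> C * (Z + Z)" using le[OF True] 1 2 by simp
    also have "\<dots> \<le> (2 * C + exp (q * \<tau>0)) * Z" using Z0 by (simp add: algebra_simps)
    finally show ?thesis unfolding Z_def .
  next
    case False
    have "Y = exp (q * \<tau>) * (exp (- q * \<tau>) * Y)" by (simp add: exp_minus)
    also have "\<dots> = exp (q * \<tau>) * Z" using 2 by simp
    also have "\<dots> \<le> exp (q * \<tau>0) * Z" using False assms Z0 by simp
    also have "\<dots> \<le> (2 * C + exp (q * \<tau>0)) * Z" using Z0 assms by simp
    finally show ?thesis using assms unfolding Z_def by linarith
  qed
qed

lemma sqd_eq_dist: "sqd x0 p = (dist x0 (snd p))\<^sup>2"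
  unfolding sqd_def power2_norm_eq_inner[symmetric] by (simp add: dist_norm norm_minus_commute)

lemma cylinder_cutoff:
  fixes x0 :: "'b::euclidean_space" and a b c d ra rb rc rd :: real
  assumes "a < b" "b < c" "c < d" "ra < rb" "rb < rc" "rc < rd"
  obtains X X' X'' where "C2jet UNIV X X' X''"
    "\<And>p. \<not> (fst p \<in> {a<..<d} \<and> sqd x0 p \<in> {ra<..<rd}) \<Longrightarrow> X p = 0"
    "\<And>p. fst p \<in> {b..c} \<Longrightarrow> sqd x0 p \<in> {rb..rc} \<Longrightarrow> X p = 1"
proof -
  obtain f f' f'' :: "real \<Rightarrow> real" where f:
    "\<And>z. (f has_real_derivative f' z) (at z)" "\<And>z. (f' has_real_derivative f'' z) (at z)"
    "continuous_on UNIV f''" "\<And>z. z \<le> a \<or> d \<le> z \<Longrightarrow> f z = 0" "\<And>z. b \<le> z \<Longrightarrow> z \<le> c \<Longrightarrow> f z = 1"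
    using C2_cutoff[OF assms(1-3)] by metis
  obtain h h' h'' :: "real \<Rightarrow> real" where h:
    "\<And>z. (h has_real_derivative h' z) (at z)" "\<And>z. (h' has_real_derivative h'' z) (at z)"
    "continuous_on UNIV h''" "\<And>z. z \<le> ra \<or> rd \<le> z \<Longrightarrow> h z = 0" "\<And>z. rb \<le> z \<Longrightarrow> z \<le> rc \<Longrightarrow> h z = 1"
    using C2_cutoff[OF assms(4-6)] by metis
  note J = C2jet_mult[OF C2jet_compose[OF C2jet_fst f(1-3)] C2jet_compose[OF C2jet_sqd[of x0] h(1-3)]]
  show ?thesis
  proof (rule that[OF J])
    fix p
    show "f (fst p) * h (sqd x0 p) = 0" if "\<not> (fst p \<in> {a<..<d} \<and> sqd x0 p \<in> {ra<..<rd})"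
    proof -
      have "(fst p \<le> a \<or> d \<le> fst p) \<or> (sqd x0 p \<le> ra \<or> rd \<le> sqd x0 p)" using that by auto
      thus ?thesis using f(4) h(4) by auto
    qed
    show "f (fst p) * h (sqd x0 p) = 1" if "fst p \<in> {b..c}" "sqd x0 p \<in> {rb..rc}"
      using that by (simp add: f(5) h(5))
  qed
qed

lemma borel_measurable_ennreal_indicator:
  fixes f :: "'a::euclidean_space \<Rightarrow> real"
  assumes "open A" "continuous_on A f"
  shows "(\<lambda>x. ennreal (f x) * indicator A x) \<in> borel_measurable borel"
proof -
  have "(\<lambda>x. indicator A x *\<^sub>R f x) \<in> borel_measurable borel"
    using assms by (intro borel_measurable_continuous_on_indicator) auto
  hence "(\<lambda>x. ennreal (indicator A x *\<^sub>R f x)) \<in> borel_measurable borel" by measurable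
  moreover have "(\<lambda>x. ennreal (indicator A x *\<^sub>R f x)) = (\<lambda>x. ennreal (f x) * indicator A x)"
    by (auto simp: indicator_def)
  ultimately show ?thesis by simp
qed

lemma heat_localised_bound:
  fixes L u B a c :: real and A :: "'n::finite set" and d V :: "'n \<Rightarrow> real"
  assumes "a\<^sup>2 \<le> B" "c\<^sup>2 \<le> B" "(\<Sum>i\<in>A. (d i)\<^sup>2) \<le> B"
  shows "(a * L + c * u - 2 * (\<Sum>i\<in>A. d i * V i))\<^sup>2 \<le> 3 * B * L\<^sup>2 + 12 * B * (u\<^sup>2 + (\<Sum>i\<in>A. (V i)\<^sup>2))"
proof -
  define s where "s = (\<Sum>i\<in>A. d i * V i)"
  define v where "v = (\<Sum>i\<in>A. (V i)\<^sup>2)"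
  have v: "0 \<le> v" by (simp add: v_def sum_nonneg)
  have B: "0 \<le> B" using assms(1) by (meson order_trans zero_le_power2)
  have "s\<^sup>2 \<le> (\<Sum>i\<in>A. (d i)\<^sup>2) * v"
    unfolding s_def v_def by (rule Cauchy_Schwarz_ineq_sum)
  also have "\<dots> \<le> B * v" using assms v by (intro mult_right_mono)
  finally have s: "s\<^sup>2 \<le> B * v" .
  have "0 \<le> (a * L - c * u)\<^sup>2 + (a * L + 2 * s)\<^sup>2 + (c * u + 2 * s)\<^sup>2" by simp
  hence "(a * L + c * u - 2 * s)\<^sup>2 \<le> 3 * (a\<^sup>2 * L\<^sup>2 + c\<^sup>2 * u\<^sup>2 + 4 * s\<^sup>2)"
    by (simp add: power2_eq_square algebra_simps)
  also have "\<dots> \<le> 3 * (B * L\<^sup>2 + B * u\<^sup>2 + 4 * (B * v))"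
    using assms s by (intro mult_left_mono add_mono mult_right_mono) auto
  also have "\<dots> \<le> 3 * B * L\<^sup>2 + 12 * B * (u\<^sup>2 + v)"
    using B by (simp add: algebra_simps)
  finally show ?thesis unfolding s_def v_def .
qed

text \<open>The Carleman weight is at least exp(-\<mu> r2^2) on the target cylinder; the cutoff
  produces errors where the weight is at most 1 (near the axis, inside the small cylinder) or at most
  exp(-\<mu> rb^2) with rb > r2 (near the lateral boundary, and near the initial and final time, where g = 1).\<close>
lemma three_cylinders_exponential:
  fixes x0 :: "real^'n::finite" and r1 r2 r3 T \<epsilon> :: real
  assumes r: "0 < r1" "r1 < r2" "r2 < r3" and \<epsilon>: "0 < \<epsilon>" "2 * \<epsilon> < T"
    and \<Omega>: "open \<Omega>" "cball x0 r3 \<subseteq> \<Omega>"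
  obtains C p q \<tau>0 :: real where "0 < C" "0 < p" "0 < q"
    "\<And>u V W \<tau>. C2jet (UNIV \<times> \<Omega>) u V W \<Longrightarrow> \<tau>0 \<le> \<tau> \<Longrightarrow>
      (\<integral>\<^sup>+z\<in>{\<epsilon><..<T - \<epsilon>} \<times> ball x0 r2. ennreal ((u z)\<^sup>2 + (\<Sum>i\<in>UNIV. (V (ex i) z)\<^sup>2)) \<partial>lborel)
      \<le> ennreal C * (ennreal (exp (p * \<tau>)) *
           ((\<integral>\<^sup>+z\<in>{0<..<T} \<times> ball x0 r1. ennreal ((u z)\<^sup>2 + (\<Sum>i\<in>UNIV. (V (ex i) z)\<^sup>2)) \<partial>lborel)
           + (\<integral>\<^sup>+z\<in>{0<..<T} \<times> ball x0 r3. ennreal ((V et z - (\<Sum>i\<in>UNIV. W (ex i) (ex i) z))\<^sup>2) \<partial>lborel))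
         + ennreal (exp (- q * \<tau>)) *
           (\<integral>\<^sup>+z\<in>{0<..<T} \<times> ball x0 r3. ennreal ((u z)\<^sup>2 + (\<Sum>i\<in>UNIV. (V (ex i) z)\<^sup>2)) \<partial>lborel))"
proof -
  define r0 where "r0 = r1 / 3"
  define ra where "ra = r1 / 2"
  define rb where "rb = (2 * r2 + r3) / 3"
  define rc where "rc = (r2 + 2 * r3) / 3"
  have rs: "0 < r0" "r0 < ra" "ra < r1" "r2 < rb" "rb < rc" "rc < r3" "ra < rb"
    using r by (auto simp: r0_def ra_def rb_def rc_def)
  define \<delta>1 where "\<delta>1 = \<epsilon> / 3"
  define \<delta> where "\<delta> = 2 * \<epsilon> / 3"
  have \<delta>: "0 < \<delta>1" "\<delta>1 < \<delta>" "\<delta> < \<epsilon>" "\<delta> < T - \<delta>" "T - \<delta> < T - \<delta>1" "T - \<epsilon> < T - \<delta>" "\<epsilon> < T - \<epsilon>"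
    using \<epsilon> by (auto simp: \<delta>1_def \<delta>_def)
  define \<mu> where "\<mu> = 2 / r0\<^sup>2"
  have \<mu>: "0 < \<mu>" using rs by (simp add: \<mu>_def)
  define K where "K = {\<delta>1..T - \<delta>1} \<times> (cball x0 rc - ball x0 r0)"
  have K: "compact K" unfolding K_def by (intro compact_Times compact_diff) auto
  have K_iff: "z \<in> K \<longleftrightarrow> fst z \<in> {\<delta>1..T - \<delta>1} \<and> sqd x0 z \<in> {r0\<^sup>2..rc\<^sup>2}" for z
  proof -
    have "dist x0 (snd z) \<le> rc \<longleftrightarrow> (dist x0 (snd z))\<^sup>2 \<le> rc\<^sup>2"
      "r0 \<le> dist x0 (snd z) \<longleftrightarrow> r0\<^sup>2 \<le> (dist x0 (snd z))\<^sup>2"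
      using rs by simp_all
    thus ?thesis by (cases z) (auto simp: K_def sqd_eq_dist)
  qed
  have K\<mu>: "2 \<le> \<mu> * sqd x0 z" if "z \<in> K" for z
    using that rs unfolding K_iff \<mu>_def by (auto simp: field_simps)
  obtain f f' f'' :: "real \<Rightarrow> real" where f:
    "\<And>z. (f has_real_derivative f' z) (at z)" "\<And>z. (f' has_real_derivative f'' z) (at z)"
    "continuous_on UNIV f''" "\<And>z. z \<le> \<delta> \<or> T - \<delta> \<le> z \<Longrightarrow> f z = 0"
    "\<And>z. \<epsilon> \<le> z \<Longrightarrow> z \<le> T - \<epsilon> \<Longrightarrow> f z = 1"
    using C2_cutoff[OF \<delta>(3) \<delta>(7) \<delta>(6)] by metis
  define g where "g z = (1 - f z)\<^sup>2" for z
  define g' where "g' z = - 2 * (1 - f z) * f' z" for z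
  define g'' where "g'' z = 2 * (f' z)\<^sup>2 - 2 * (1 - f z) * f'' z" for z
  have g: "(g has_real_derivative g' z) (at z)" "(g' has_real_derivative g'' z) (at z)" for z
    subgoal unfolding g_def g'_def
      by (rule derivative_eq_intros f(1) refl)+ (simp add: algebra_simps)
    subgoal unfolding g'_def g''_def
      by (rule derivative_eq_intros f(1,2) refl)+ (simp add: algebra_simps power2_eq_square)
    done
  have gc: "continuous_on UNIV g''"
  proof -
    have "continuous_on UNIV f" "continuous_on UNIV f'"
      using f(1,2) by (auto intro!: continuous_at_imp_continuous_on intro: DERIV_isCont)
    thus ?thesis unfolding g''_def by (intro continuous_intros f(3))
  qed
  define \<phi> where "\<phi> z = exp (- \<mu> * sqd x0 z) - g (fst z)" for z
  obtain c \<tau>0 where c: "0 < c" "1 \<le> \<tau>0"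
    and carleman: "\<And>\<tau> w V W. \<tau>0 \<le> \<tau> \<Longrightarrow> C2jet UNIV w V W \<Longrightarrow> (\<And>z. z \<notin> K \<Longrightarrow> w z = 0) \<Longrightarrow>
      ennreal c * (\<integral>\<^sup>+z. ennreal (exp (2 * \<tau> * \<phi> z) * ((w z)\<^sup>2 + (\<Sum>i\<in>UNIV. (V (ex i) z)\<^sup>2))) \<partial>lborel)
      \<le> (\<integral>\<^sup>+z. ennreal (exp (2 * \<tau> * \<phi> z) * (V et z - (\<Sum>i\<in>UNIV. W (ex i) (ex i) z))\<^sup>2) \<partial>lborel)"
    by (rule carleman_estimate[OF g gc \<mu> K K\<mu>, folded \<phi>_def], assumption) (rule that; blast)
  have sq: "r0\<^sup>2 < ra\<^sup>2" "ra\<^sup>2 < rb\<^sup>2" "rb\<^sup>2 < rc\<^sup>2"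
    using rs by (auto intro!: power_strict_mono)
  obtain X X' X'' where X: "C2jet UNIV X X' X''"
    and X0: "\<And>z. \<not> (fst z \<in> {\<delta>1<..<T - \<delta>1} \<and> sqd x0 z \<in> {r0\<^sup>2<..<rc\<^sup>2}) \<Longrightarrow> X z = 0"
    and X1: "\<And>z. fst z \<in> {\<delta>..T - \<delta>} \<Longrightarrow> sqd x0 z \<in> {ra\<^sup>2..rb\<^sup>2} \<Longrightarrow> X z = 1"
    using cylinder_cutoff[OF \<delta>(2,4,5) sq, of x0] by metis
  have X0K: "X z = 0" if "z \<notin> K" for z using that by (intro X0) (auto simp: K_iff)
  have X'0: "X' e z = 0" "X'' e f z = 0" if "z \<notin> K" for e f z
    using C2jet_locally_const(1)[OF X, of "-K" 0 z e] C2jet_locally_const(2)[OF X, of "-K" 0 z e f] X0K K that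
    by (auto simp: compact_imp_closed open_Compl)
  define Good where "Good = {\<delta><..<T - \<delta>} \<times> (ball x0 rb - cball x0 ra)"
  have Good_open: "open Good" unfolding Good_def by (intro open_Times open_Diff) auto
  have Good_iff: "z \<in> Good \<longleftrightarrow> fst z \<in> {\<delta><..<T - \<delta>} \<and> sqd x0 z \<in> {ra\<^sup>2<..<rb\<^sup>2}" for z
  proof -
    have "dist x0 (snd z) < rb \<longleftrightarrow> (dist x0 (snd z))\<^sup>2 < rb\<^sup>2" "ra < dist x0 (snd z) \<longleftrightarrow> ra\<^sup>2 < (dist x0 (snd z))\<^sup>2"
      using rs by (simp_all add: not_le[symmetric])
    thus ?thesis by (cases z) (auto simp: Good_def sqd_eq_dist)
  qed
  have XG: "X z = 1" "X' e z = 0" "X'' e f z = 0" if "z \<in> Good" for e f z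
  proof -
    have 1: "X z = 1" if "z \<in> Good" for z using that by (intro X1) (auto simp: Good_iff)
    thus "X z = 1" using that .
    show "X' e z = 0" "X'' e f z = 0"
      using C2jet_locally_const[OF X Good_open _ 1 that] by auto
  qed
  define cX where "cX z = X' et z - (\<Sum>i\<in>UNIV. X'' (ex i) (ex i) z)" for z
  define dX where "dX z = (\<Sum>i\<in>UNIV. (X' (ex i) z)\<^sup>2)" for z
  have "continuous_on UNIV (\<lambda>z. (X z)\<^sup>2 + (cX z)\<^sup>2 + dX z)"
    unfolding cX_def dX_def by (intro continuous_intros C2jetD(3,4,5)[OF X])
  then obtain B where B: "0 \<le> B" "\<And>z. z \<in> K \<Longrightarrow> \<bar>(X z)\<^sup>2 + (cX z)\<^sup>2 + dX z\<bar> \<le> B"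
    by (rule bounded_on_compact[OF K continuous_on_subset[OF _ subset_UNIV]]) (rule that; blast)
  define D where "D = 12 * (B + 1)"
  have D: "0 < D" using B by (simp add: D_def)
  define h2 where "h2 = exp (- \<mu> * r2\<^sup>2)"
  define hb where "hb = exp (- \<mu> * rb\<^sup>2)"
  have hb: "hb < h2" "h2 < 1" "0 < hb"
  proof -
    have "r2\<^sup>2 < rb\<^sup>2" using rs r by (intro power_strict_mono) auto
    thus "hb < h2" "h2 < 1" "0 < hb" using \<mu> r by (auto simp: hb_def h2_def)
  qed
  show ?thesis
  proof (rule that[of "D / c + 1" "2 * (1 - h2)" "2 * (h2 - hb)" \<tau>0])
    fix u :: "real \<times> (real^'n) \<Rightarrow> real" and V W and \<tau> :: real
    assume u: "C2jet (UNIV \<times> \<Omega>) u V W" and \<tau>: "\<tau>0 \<le> \<tau>"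
    have \<tau>1: "1 \<le> \<tau>" using \<tau> c by simp
    define U where "U z = (u z)\<^sup>2 + (\<Sum>i\<in>UNIV. (V (ex i) z)\<^sup>2)" for z
    define H where "H z = (V et z - (\<Sum>i\<in>UNIV. W (ex i) (ex i) z))\<^sup>2" for z
    have U0: "0 \<le> U z" and H0: "0 \<le> H z" for z by (simp_all add: U_def H_def sum_nonneg)
    define Q1 where "Q1 = {0<..<T} \<times> ball x0 r1"
    define Q2 where "Q2 = {\<epsilon><..<T - \<epsilon>} \<times> ball x0 r2"
    define G2 where "G2 = {\<epsilon><..<T - \<epsilon>} \<times> (ball x0 r2 - cball x0 ra)"
    define Q3 where "Q3 = {0<..<T} \<times> ball x0 r3"
    have op: "open Q1" "open Q2" "open G2" "open Q3"
      unfolding Q1_def Q2_def G2_def Q3_def by (intro open_Times open_Diff; simp)+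
    have Q3\<Omega>: "Q3 \<subseteq> UNIV \<times> \<Omega>" using \<Omega> by (auto simp: Q3_def)
    have sub: "Q1 \<subseteq> Q3" "G2 \<subseteq> Q3" "Q2 \<subseteq> Q3" "K \<subseteq> Q3" "G2 \<subseteq> Good" "Q2 \<subseteq> G2 \<union> Q1"
      using r rs \<delta> \<epsilon> by (auto simp: Q1_def Q2_def G2_def Q3_def K_def Good_def)
    have cU: "continuous_on Q3 U" and cH: "continuous_on Q3 H"
      unfolding U_def H_def
      by (intro continuous_intros continuous_on_subset[OF C2jetD(3)[OF u] Q3\<Omega>]
        continuous_on_subset[OF C2jetD(4)[OF u] Q3\<Omega>] continuous_on_subset[OF C2jetD(5)[OF u] Q3\<Omega>])+
    have mU: "(\<lambda>z. ennreal (U z) * indicator A z) \<in> borel_measurable borel" if "open A" "A \<subseteq> Q3" for A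
      using that by (intro borel_measurable_ennreal_indicator continuous_on_subset[OF cU])
    have mH: "(\<lambda>z. ennreal (H z) * indicator Q3 z) \<in> borel_measurable borel"
      using op by (intro borel_measurable_ennreal_indicator cH)
    define w where "w z = X z * u z" for z
    define w' where "w' e z = X' e z * u z + X z * V e z" for e z
    define w'' where "w'' e f z = X'' e f z * u z + X' e z * V f z + X' f z * V e z + X z * W e f z" for e f z
    have w: "C2jet UNIV w w' w''"
      unfolding w_def w'_def w''_def
      using sub(4) Q3\<Omega> \<Omega> K X0K
      by (intro C2jet_mult_cutoff[OF X u, where K = K]) (auto simp: open_Times compact_imp_closed)
    have w0: "w z = 0" if "z \<notin> K" for z using X0K that by (simp add: w_def)
    define Lw where "Lw z = w' et z - (\<Sum>i\<in>UNIV. w'' (ex i) (ex i) z)" for z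
    have Lw: "Lw z = X z * (V et z - (\<Sum>i\<in>UNIV. W (ex i) (ex i) z)) + cX z * u z
        - 2 * (\<Sum>i\<in>UNIV. X' (ex i) z * V (ex i) z)" for z
      unfolding Lw_def w'_def w''_def cX_def
      by (simp add: sum.distrib sum_distrib_left sum_distrib_right algebra_simps)
    have e1: "exp (2 * \<tau> * \<phi> z) \<le> exp (2 * \<tau>)" for z
    proof -
      have "exp (- \<mu> * sqd x0 z) \<le> 1" using \<mu> by (simp add: sqd_def)
      moreover have "0 \<le> g (fst z)" by (simp add: g_def)
      ultimately have "\<phi> z \<le> 1" unfolding \<phi>_def by linarith
      thus ?thesis using \<tau>1 by simp
    qed
    have upper: "exp (2 * \<tau> * \<phi> z) * (Lw z)\<^sup>2 \<le> D * exp (2 * \<tau>) * (H z * indicator Q3 z)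
        + (D * exp (2 * \<tau>) * (U z * indicator Q1 z) + D * exp (2 * \<tau> * hb) * (U z * indicator Q3 z))" for z
    proof (cases "z \<in> K")
      case False
      hence "Lw z = 0" unfolding Lw by (simp add: X0K X'0 cX_def)
      thus ?thesis using D U0 H0 by simp
    next
      case K: True
      hence Q3: "z \<in> Q3" using sub by auto
      have nn: "0 \<le> D * exp (2 * \<tau>) * (U z * indicator Q1 z)" "0 \<le> D * exp (2 * \<tau> * hb) * (U z * indicator Q3 z)"
        using D U0 by simp_all
      show ?thesis
      proof (cases "z \<in> Good")
        case True
        hence "(Lw z)\<^sup>2 = H z" unfolding Lw H_def by (simp add: XG cX_def)
        moreover have "exp (2 * \<tau> * \<phi> z) * H z \<le> D * exp (2 * \<tau>) * H z"
        proof (rule mult_right_mono[OF _ H0])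
          have "1 * exp (2 * \<tau>) \<le> D * exp (2 * \<tau>)" using B by (intro mult_right_mono) (auto simp: D_def)
          thus "exp (2 * \<tau> * \<phi> z) \<le> D * exp (2 * \<tau>)" using e1[of z] by linarith
        qed
        ultimately show ?thesis using nn Q3 by simp
      next
        case False
        have dX0: "0 \<le> dX z" by (simp add: dX_def sum_nonneg)
        have "(Lw z)\<^sup>2 \<le> 3 * B * H z + 12 * B * U z"
          unfolding Lw H_def U_def
          by (rule heat_localised_bound) (use B(2)[OF K] dX0 in \<open>auto simp: dX_def[symmetric] intro: order_trans[rotated]\<close>)
        also have "\<dots> \<le> D * H z + D * U z"
          using B U0[of z] H0[of z] by (intro add_mono mult_right_mono) (auto simp: D_def)
        finally have L: "(Lw z)\<^sup>2 \<le> D * H z + D * U z" .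
        have "exp (2 * \<tau> * \<phi> z) * (Lw z)\<^sup>2 \<le> exp (2 * \<tau> * \<phi> z) * (D * H z + D * U z)"
          using L by (intro mult_left_mono) auto
        also have "\<dots> = D * (exp (2 * \<tau> * \<phi> z) * H z) + D * (exp (2 * \<tau> * \<phi> z) * U z)"
          by (simp add: algebra_simps)
        also have "D * (exp (2 * \<tau> * \<phi> z) * H z) \<le> D * exp (2 * \<tau>) * (H z * indicator Q3 z)"
          using e1[of z] H0[of z] D Q3 by (simp add: mult_right_mono)
        also have "D * (exp (2 * \<tau> * \<phi> z) * U z)
          \<le> D * exp (2 * \<tau>) * (U z * indicator Q1 z) + D * exp (2 * \<tau> * hb) * (U z * indicator Q3 z)"
        proof (cases "z \<in> Q1")
          case True
          have "D * (exp (2 * \<tau> * \<phi> z) * U z) \<le> D * exp (2 * \<tau>) * (U z * indicator Q1 z)"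
            using e1[of z] U0[of z] D True by (simp add: mult_right_mono)
          thus ?thesis using nn by linarith
        next
          case notQ1: False
          have "\<phi> z \<le> hb"
          proof (cases "fst z \<in> {\<delta><..<T - \<delta>}")
            case True
            have "sqd x0 z > ra\<^sup>2"
            proof (rule ccontr)
              assume "\<not> sqd x0 z > ra\<^sup>2"
              hence "dist x0 (snd z) \<le> ra" using rs by (simp add: sqd_eq_dist not_less)
              thus False using notQ1 rs K \<delta> by (cases z) (auto simp: Q1_def K_def)
            qed
            hence "rb\<^sup>2 \<le> sqd x0 z" using True False by (auto simp: Good_iff)
            hence "exp (- \<mu> * sqd x0 z) \<le> hb" using \<mu> by (simp add: hb_def)
            moreover have "0 \<le> g (fst z)" by (simp add: g_def)
            ultimately show ?thesis unfolding \<phi>_def by linarith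
          next
            case False
            hence "g (fst z) = 1" unfolding g_def by (subst f(4)) auto
            moreover have "exp (- \<mu> * sqd x0 z) \<le> 1" using \<mu> by (simp add: sqd_def)
            ultimately show ?thesis using hb unfolding \<phi>_def by linarith
          qed
          hence "exp (2 * \<tau> * \<phi> z) \<le> exp (2 * \<tau> * hb)" using \<tau>1 by simp
          hence "D * (exp (2 * \<tau> * \<phi> z) * U z) \<le> D * exp (2 * \<tau> * hb) * (U z * indicator Q3 z)"
            using U0[of z] D Q3 by (simp add: mult_right_mono)
          thus ?thesis using nn by linarith
        qed
        finally show ?thesis by simp
      qed
    qed
    have lower: "exp (2 * \<tau> * h2) * (U z * indicator G2 z)
        \<le> exp (2 * \<tau> * \<phi> z) * ((w z)\<^sup>2 + (\<Sum>i\<in>UNIV. (w' (ex i) z)\<^sup>2))" for z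
    proof (cases "z \<in> G2")
      case True
      hence G: "z \<in> Good" using sub by auto
      have "(w z)\<^sup>2 + (\<Sum>i\<in>UNIV. (w' (ex i) z)\<^sup>2) = U z"
        by (simp add: w_def w'_def U_def XG[OF G])
      moreover have "h2 \<le> \<phi> z"
      proof -
        have "sqd x0 z \<le> r2\<^sup>2" using True by (auto simp: G2_def sqd_eq_dist intro!: power_mono)
        hence "h2 \<le> exp (- \<mu> * sqd x0 z)" using \<mu> by (simp add: h2_def)
        moreover have "g (fst z) = 0" unfolding g_def using True by (subst f(5)) (auto simp: G2_def)
        ultimately show ?thesis by (simp add: \<phi>_def)
      qed
      ultimately show ?thesis using True U0[of z] \<tau>1 by (simp add: mult_right_mono)
    next
      case False
      thus ?thesis by (simp add: sum_nonneg)
    qed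
    define I where "I A = (\<integral>\<^sup>+z\<in>A. ennreal (U z) \<partial>lborel)" for A
    define J where "J = (\<integral>\<^sup>+z\<in>Q3. ennreal (H z) \<partial>lborel)"
    have cm: "(\<integral>\<^sup>+z. ennreal k * (ennreal (f z) * indicator A z) \<partial>lborel) = ennreal k * (\<integral>\<^sup>+z\<in>A. ennreal (f z) \<partial>lborel)"
      if "(\<lambda>z. ennreal (f z) * indicator A z) \<in> borel_measurable borel"
      for k :: real and f :: "real \<times> (real^'n) \<Rightarrow> real" and A
      using that by (intro nn_integral_cmult) simp
    have ei: "ennreal (k * (f z * indicator A z)) = ennreal k * (ennreal (f z) * indicator A z)"
      if "0 \<le> k" "0 \<le> f z" for k :: real and f :: "real \<times> (real^'n) \<Rightarrow> real" and A z
      using that by (auto simp: indicator_def ennreal_mult)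
    have "ennreal (exp (2 * \<tau> * h2)) * I G2 = (\<integral>\<^sup>+z. ennreal (exp (2 * \<tau> * h2) * (U z * indicator G2 z)) \<partial>lborel)"
      unfolding I_def using U0 by (simp add: ei cm mU op sub)
    also have "\<dots> \<le> (\<integral>\<^sup>+z. ennreal (exp (2 * \<tau> * \<phi> z) * ((w z)\<^sup>2 + (\<Sum>i\<in>UNIV. (w' (ex i) z)\<^sup>2))) \<partial>lborel)"
      using lower by (intro nn_integral_mono ennreal_leI)
    finally have "ennreal c * (ennreal (exp (2 * \<tau> * h2)) * I G2)
      \<le> ennreal c * (\<integral>\<^sup>+z. ennreal (exp (2 * \<tau> * \<phi> z) * ((w z)\<^sup>2 + (\<Sum>i\<in>UNIV. (w' (ex i) z)\<^sup>2))) \<partial>lborel)"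
      by (rule mult_left_mono) simp
    also have "\<dots> \<le> (\<integral>\<^sup>+z. ennreal (exp (2 * \<tau> * \<phi> z) * (Lw z)\<^sup>2) \<partial>lborel)"
      unfolding Lw_def by (rule carleman[OF \<tau> w w0])
    also have "\<dots> \<le> (\<integral>\<^sup>+z. ennreal (D * exp (2 * \<tau>)) * (ennreal (H z) * indicator Q3 z)
        + (ennreal (D * exp (2 * \<tau>)) * (ennreal (U z) * indicator Q1 z)
           + ennreal (D * exp (2 * \<tau> * hb)) * (ennreal (U z) * indicator Q3 z)) \<partial>lborel)"
    proof (rule nn_integral_mono)
      fix z
      have "ennreal (exp (2 * \<tau> * \<phi> z) * (Lw z)\<^sup>2) \<le> ennreal (D * exp (2 * \<tau>) * (H z * indicator Q3 z)
        + (D * exp (2 * \<tau>) * (U z * indicator Q1 z) + D * exp (2 * \<tau> * hb) * (U z * indicator Q3 z)))"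
        using upper by (rule ennreal_leI)
      also have "\<dots> = ennreal (D * exp (2 * \<tau>) * (H z * indicator Q3 z))
        + (ennreal (D * exp (2 * \<tau>) * (U z * indicator Q1 z)) + ennreal (D * exp (2 * \<tau> * hb) * (U z * indicator Q3 z)))"
        using D U0 H0 by (simp add: ennreal_plus)
      finally show "ennreal (exp (2 * \<tau> * \<phi> z) * (Lw z)\<^sup>2) \<le> ennreal (D * exp (2 * \<tau>)) * (ennreal (H z) * indicator Q3 z)
        + (ennreal (D * exp (2 * \<tau>)) * (ennreal (U z) * indicator Q1 z)
           + ennreal (D * exp (2 * \<tau> * hb)) * (ennreal (U z) * indicator Q3 z))"
        using D U0 H0 by (simp only: ei mult_nonneg_nonneg less_imp_le exp_ge_zero)
    qed
    also have "\<dots> = ennreal (D * exp (2 * \<tau>)) * J + (ennreal (D * exp (2 * \<tau>)) * I Q1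
        + ennreal (D * exp (2 * \<tau> * hb)) * I Q3)"
      unfolding I_def J_def using mU[OF op(1) sub(1)] mU[OF op(4) order_refl] mH
      by (subst nn_integral_add; (subst nn_integral_add)?; simp add: cm)
    finally have main: "ennreal c * (ennreal (exp (2 * \<tau> * h2)) * I G2)
      \<le> ennreal (D * exp (2 * \<tau>)) * J + (ennreal (D * exp (2 * \<tau>)) * I Q1 + ennreal (D * exp (2 * \<tau> * hb)) * I Q3)" .
    define m where "m = 1 / (c * exp (2 * \<tau> * h2))"
    have m: "0 < m" using c by (simp add: m_def)
    have "I G2 = ennreal (m * (c * exp (2 * \<tau> * h2))) * I G2"
      using c by (simp add: m_def)
    also have "\<dots> = ennreal m * (ennreal c * (ennreal (exp (2 * \<tau> * h2)) * I G2))"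
      using c m by (simp add: ennreal_mult mult.assoc)
    also have "\<dots> \<le> ennreal m * (ennreal (D * exp (2 * \<tau>)) * J + (ennreal (D * exp (2 * \<tau>)) * I Q1 + ennreal (D * exp (2 * \<tau> * hb)) * I Q3))"
      using main by (rule mult_left_mono) simp
    also have "\<dots> = ennreal (m * (D * exp (2 * \<tau>))) * (I Q1 + J) + ennreal (m * (D * exp (2 * \<tau> * hb))) * I Q3"
      using m D by (simp add: ennreal_mult distrib_left mult.assoc add_ac)
    also have "m * (D * exp (2 * \<tau>)) = D / c * exp (2 * (1 - h2) * \<tau>)"
      unfolding m_def by (simp add: exp_diff algebra_simps)
    also have "m * (D * exp (2 * \<tau> * hb)) = D / c * exp (- (2 * (h2 - hb)) * \<tau>)"
      unfolding m_def by (simp add: exp_diff algebra_simps)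
    finally have G2: "I G2 \<le> ennreal (D / c * exp (2 * (1 - h2) * \<tau>)) * (I Q1 + J)
      + ennreal (D / c * exp (- (2 * (h2 - hb)) * \<tau>)) * I Q3" .
    have "I Q2 \<le> (\<integral>\<^sup>+z. ennreal (U z) * indicator G2 z + ennreal (U z) * indicator Q1 z \<partial>lborel)"
      unfolding I_def using sub(6)
      by (intro nn_integral_mono) (auto simp: indicator_def)
    also have "\<dots> = I G2 + I Q1"
      unfolding I_def using mU[OF op(1) sub(1)] mU[OF op(3) sub(2)] by (intro nn_integral_add) auto
    also have "I Q1 \<le> ennreal (exp (2 * (1 - h2) * \<tau>)) * (I Q1 + J)"
    proof -
      have "1 * I Q1 \<le> ennreal (exp (2 * (1 - h2) * \<tau>)) * (I Q1 + J)"
        using hb \<tau>1 by (intro mult_mono) auto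
      thus ?thesis by simp
    qed
    finally have "I Q2 \<le> I G2 + ennreal (exp (2 * (1 - h2) * \<tau>)) * (I Q1 + J)" by simp
    also have "\<dots> \<le> (ennreal (D / c * exp (2 * (1 - h2) * \<tau>)) * (I Q1 + J)
      + ennreal (D / c * exp (- (2 * (h2 - hb)) * \<tau>)) * I Q3) + ennreal (exp (2 * (1 - h2) * \<tau>)) * (I Q1 + J)"
      using G2 by (rule add_right_mono)
    also have "\<dots> = ennreal ((D / c + 1) * exp (2 * (1 - h2) * \<tau>)) * (I Q1 + J)
      + ennreal (D / c * exp (- (2 * (h2 - hb)) * \<tau>)) * I Q3"
    proof -
      have "ennreal ((D / c + 1) * exp (2 * (1 - h2) * \<tau>))
          = ennreal (D / c * exp (2 * (1 - h2) * \<tau>)) + ennreal (exp (2 * (1 - h2) * \<tau>))"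
        using D c by (subst ennreal_plus[symmetric]) (auto simp: algebra_simps)
      thus ?thesis by (simp add: distrib_right add_ac)
    qed
    also have "\<dots> \<le> ennreal ((D / c + 1) * exp (2 * (1 - h2) * \<tau>)) * (I Q1 + J)
      + ennreal ((D / c + 1) * exp (- (2 * (h2 - hb)) * \<tau>)) * I Q3"
      by (intro add_left_mono mult_right_mono ennreal_leI) auto
    also have "\<dots> = ennreal (D / c + 1) * (ennreal (exp (2 * (1 - h2) * \<tau>)) * (I Q1 + J)
      + ennreal (exp (- (2 * (h2 - hb)) * \<tau>)) * I Q3)"
      using D c by (simp add: ennreal_mult distrib_left mult.assoc)
    finally show "(\<integral>\<^sup>+z\<in>{\<epsilon><..<T - \<epsilon>} \<times> ball x0 r2. ennreal ((u z)\<^sup>2 + (\<Sum>i\<in>UNIV. (V (ex i) z)\<^sup>2)) \<partial>lborel)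
      \<le> ennreal (D / c + 1) * (ennreal (exp (2 * (1 - h2) * \<tau>)) *
           ((\<integral>\<^sup>+z\<in>{0<..<T} \<times> ball x0 r1. ennreal ((u z)\<^sup>2 + (\<Sum>i\<in>UNIV. (V (ex i) z)\<^sup>2)) \<partial>lborel)
           + (\<integral>\<^sup>+z\<in>{0<..<T} \<times> ball x0 r3. ennreal ((V et z - (\<Sum>i\<in>UNIV. W (ex i) (ex i) z))\<^sup>2) \<partial>lborel))
         + ennreal (exp (- (2 * (h2 - hb)) * \<tau>)) *
           (\<integral>\<^sup>+z\<in>{0<..<T} \<times> ball x0 r3. ennreal ((u z)\<^sup>2 + (\<Sum>i\<in>UNIV. (V (ex i) z)\<^sup>2)) \<partial>lborel))"
      unfolding I_def J_def Q1_def Q2_def Q3_def U_def H_def .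
  qed (use D c hb in \<open>auto intro: add_pos_pos\<close>)
qed

section \<open>The norms\<close>

lemma ennpowr_ennreal: "0 \<le> x \<Longrightarrow> ennpowr (ennreal x) a = ennreal (x powr a)"
  by (simp add: ennpowr_def)

lemma ennpowr_mono:
  assumes "x \<le> y" "0 \<le> a"
  shows "ennpowr x a \<le> ennpowr y a"
proof (cases "y = \<infinity>")
  case True
  thus ?thesis by (simp add: ennpowr_def)
next
  case False
  hence fin: "x \<noteq> \<infinity>" "y \<noteq> \<infinity>" using assms by (auto simp: top_unique)
  hence "enn2real x \<le> enn2real y" using assms by (intro enn2real_mono) (auto simp: less_top)
  thus ?thesis using fin assms by (auto simp: ennpowr_def intro!: ennreal_leI powr_mono2)
qed

lemma ennpowr_half_power2: "(ennpowr x (1/2))\<^sup>2 = x"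
proof (cases "x = \<infinity>")
  case True
  thus ?thesis by (simp add: ennpowr_def power2_eq_square)
next
  case False
  hence "x = ennreal (enn2real x)" by (simp add: less_top)
  moreover have "(enn2real x powr (1/2))\<^sup>2 = enn2real x" by (simp add: powr_half_sqrt)
  ultimately show ?thesis using False by (simp add: ennpowr_def ennreal_power)
qed

lemma L2H1_norm_unfold:
  "L2H1_norm a b S u = ennpowr (\<integral>\<^sup>+t\<in>{a<..<b}. ((\<integral>\<^sup>+x\<in>S. ennreal ((u (t, x))\<^sup>2) \<partial>lborel)
     + (\<integral>\<^sup>+x\<in>S. ennreal ((norm (gradient (\<lambda>x. u (t, x)) x))\<^sup>2) \<partial>lborel)) \<partial>lborel) (1/2)"
  by (simp add: L2H1_norm_def H1_norm_def L2_norm_def ennpowr_half_power2)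

lemma L2H1_norm_mono:
  assumes "S \<subseteq> S'"
  shows "L2H1_norm a b S u \<le> L2H1_norm a b S' u"
proof -
  have "indicator S x \<le> (indicator S' x :: ennreal)" for x
    using assms by (auto simp: indicator_def)
  thus ?thesis
    unfolding L2H1_norm_unfold
    by (intro ennpowr_mono nn_integral_mono mult_right_mono mult_left_mono add_mono) auto
qed

lemma L2_norm_mono:
  assumes "S \<subseteq> S'"
  shows "L2_norm S f \<le> L2_norm S' f"
  unfolding L2_norm_def using assms
  by (intro ennpowr_mono nn_integral_mono) (auto simp: indicator_def)

lemma C2jet_slice:
  fixes u :: "real \<times> (real^'n::finite) \<Rightarrow> real"
  assumes u: "C2jet (UNIV \<times> \<Omega>) u V W" and \<Omega>: "open \<Omega>" and x: "x \<in> \<Omega>"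
  shows "partial i (\<lambda>y. u (t, y)) x = V (ex i) (t, x)"
    and "partial i (partial i (\<lambda>y. u (t, y))) x = W (ex i) (ex i) (t, x)"
    and "deriv (\<lambda>s. u (s, x)) t = V et (t, x)"
proof -
  have tx: "(t, y) \<in> UNIV \<times> \<Omega>" if "y \<in> \<Omega>" for t y using that by simp
  have pair: "((\<lambda>y. (t, y)) has_derivative (\<lambda>h. (0, h))) (at y)" for y :: "real^'n"
    by (auto intro!: derivative_eq_intros)
  have 1: "partial i (\<lambda>y. u (t, y)) y = V (ex i) (t, y)" if "y \<in> \<Omega>" for y
  proof -
    have "((\<lambda>y. u (t, y)) has_derivative (\<lambda>h. V (0, h) (t, y))) (at y)"
      using has_derivative_compose[OF pair C2jetD(1)[OF u tx[OF that]]] .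
    thus ?thesis unfolding partial_def by (simp add: frechet_derivative_at[symmetric])
  qed
  show "partial i (\<lambda>y. u (t, y)) x = V (ex i) (t, x)" using 1 x .
  have "((\<lambda>y. V (ex i) (t, y)) has_derivative (\<lambda>h. W (ex i) (0, h) (t, x))) (at x)"
    using has_derivative_compose[OF pair C2jetD(2)[OF u tx[OF x]]] .
  hence "(partial i (\<lambda>y. u (t, y)) has_derivative (\<lambda>h. W (ex i) (0, h) (t, x))) (at x)"
    by (rule has_derivative_transform_within_open[OF _ \<Omega> x]) (simp add: 1)
  thus "partial i (partial i (\<lambda>y. u (t, y))) x = W (ex i) (ex i) (t, x)"
    by (subst partial_def) (simp add: frechet_derivative_at[symmetric])
  have "((\<lambda>s. u ((t, x) + s *\<^sub>R et)) has_real_derivative V et (t, x)) (at 0)"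
    by (rule has_directional_deriv[OF C2jetD(1)[OF u tx[OF x]]])
  hence "((\<lambda>s. u (s + t, x)) has_real_derivative V et (t, x)) (at 0)"
    by (simp add: add.commute)
  hence "((\<lambda>s. u (s, x)) has_real_derivative V et (t, x)) (at t)"
    using DERIV_shift[of "\<lambda>s. u (s, x)" "V et (t, x)" 0 t] by simp
  thus "deriv (\<lambda>s. u (s, x)) t = V et (t, x)" by (rule DERIV_imp_deriv)
qed

lemma L2H1_norm_eq:
  fixes u :: "real \<times> (real^'n::finite) \<Rightarrow> real"
  assumes u: "C2jet (UNIV \<times> \<Omega>) u V W" and \<Omega>: "open \<Omega>" and S: "open S" "S \<subseteq> \<Omega>"
  shows "L2H1_norm a b S u
    = ennpowr (\<integral>\<^sup>+z\<in>{a<..<b} \<times> S. ennreal ((u z)\<^sup>2 + (\<Sum>i\<in>UNIV. (V (ex i) z)\<^sup>2)) \<partial>lborel) (1/2)"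
proof -
  define U where "U z = (u z)\<^sup>2 + (\<Sum>i\<in>UNIV. (V (ex i) z)\<^sup>2)" for z
  have cu: "continuous_on (UNIV \<times> \<Omega>) u" and cV: "continuous_on (UNIV \<times> \<Omega>) (V e)" for e
    using C2jetD(4,5)[OF u] by auto
  have cU: "continuous_on (UNIV \<times> \<Omega>) U"
    unfolding U_def by (intro continuous_intros cu cV)
  have inner: "(\<integral>\<^sup>+x\<in>S. ennreal ((u (t, x))\<^sup>2) \<partial>lborel)
     + (\<integral>\<^sup>+x\<in>S. ennreal ((norm (gradient (\<lambda>x. u (t, x)) x))\<^sup>2) \<partial>lborel)
     = (\<integral>\<^sup>+x\<in>S. ennreal (U (t, x)) \<partial>lborel)" for t
  proof -
    have g: "(norm (gradient (\<lambda>x. u (t, x)) x))\<^sup>2 = (\<Sum>i\<in>UNIV. (V (ex i) (t, x))\<^sup>2)" if "x \<in> S" for x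
      using that S
      by (simp add: norm_vec_def L2_set_def sum_nonneg gradient_def C2jet_slice(1)[OF u \<Omega>] subsetD)
    have ct: "continuous_on S (\<lambda>x. f (t, x))" if "continuous_on (UNIV \<times> \<Omega>) f" for f :: "real \<times> (real^'n) \<Rightarrow> real"
      using S by (intro continuous_on_compose2[OF that] continuous_intros) auto
    have m1: "(\<lambda>x. ennreal ((u (t, x))\<^sup>2) * indicator S x) \<in> borel_measurable borel"
      by (intro borel_measurable_ennreal_indicator S continuous_intros ct cu)
    have m2: "(\<lambda>x. ennreal (\<Sum>i\<in>UNIV. (V (ex i) (t, x))\<^sup>2) * indicator S x) \<in> borel_measurable borel"
      by (intro borel_measurable_ennreal_indicator S continuous_intros ct cV)
    have "(\<integral>\<^sup>+x\<in>S. ennreal ((norm (gradient (\<lambda>x. u (t, x)) x))\<^sup>2) \<partial>lborel)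
      = (\<integral>\<^sup>+x\<in>S. ennreal (\<Sum>i\<in>UNIV. (V (ex i) (t, x))\<^sup>2) \<partial>lborel)"
      using g by (intro nn_integral_cong) (auto simp: indicator_def)
    hence "(\<integral>\<^sup>+x\<in>S. ennreal ((u (t, x))\<^sup>2) \<partial>lborel)
     + (\<integral>\<^sup>+x\<in>S. ennreal ((norm (gradient (\<lambda>x. u (t, x)) x))\<^sup>2) \<partial>lborel)
     = (\<integral>\<^sup>+x. ennreal ((u (t, x))\<^sup>2) * indicator S x
         + ennreal (\<Sum>i\<in>UNIV. (V (ex i) (t, x))\<^sup>2) * indicator S x \<partial>lborel)"
      using m1 m2 by (subst nn_integral_add) auto
    also have "\<dots> = (\<integral>\<^sup>+x\<in>S. ennreal (U (t, x)) \<partial>lborel)"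
      by (intro nn_integral_cong) (simp add: U_def ennreal_plus sum_nonneg distrib_right)
    finally show ?thesis .
  qed
  have m: "(\<lambda>z. ennreal (U z) * indicator ({a<..<b} \<times> S) z) \<in> borel_measurable borel"
    using S by (intro borel_measurable_ennreal_indicator continuous_on_subset[OF cU]) (auto simp: open_Times)
  have "(\<integral>\<^sup>+z\<in>{a<..<b} \<times> S. ennreal (U z) \<partial>lborel)
      = (\<integral>\<^sup>+t. (\<integral>\<^sup>+x. ennreal (U (t, x)) * indicator ({a<..<b} \<times> S) (t, x) \<partial>lborel) \<partial>lborel)"
    using m by (subst lborel.nn_integral_fst) (simp_all add: lborel_prod)
  also have "\<dots> = (\<integral>\<^sup>+t\<in>{a<..<b}. (\<integral>\<^sup>+x\<in>S. ennreal (U (t, x)) \<partial>lborel) \<partial>lborel)"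
    by (intro nn_integral_cong) (auto simp: indicator_def)
  finally show ?thesis unfolding L2H1_norm_unfold inner U_def by simp
qed

lemma nn_set_integral_finite:
  fixes f :: "'a::euclidean_space \<Rightarrow> real"
  assumes "compact K" "A \<subseteq> K" "continuous_on K f"
  shows "(\<integral>\<^sup>+z\<in>A. ennreal (f z) \<partial>lborel) < \<infinity>"
proof -
  obtain B where B: "0 \<le> B" "\<And>z. z \<in> K \<Longrightarrow> \<bar>f z\<bar> \<le> B"
    by (rule bounded_on_compact[OF assms(1,3)]) (rule that; blast)
  have "(\<integral>\<^sup>+z\<in>A. ennreal (f z) \<partial>lborel) \<le> (\<integral>\<^sup>+z. ennreal B * indicator K z \<partial>lborel)"
    using B(2) assms(2) by (intro nn_integral_mono) (force simp: indicator_def intro!: ennreal_leI)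
  also have "\<dots> = ennreal B * emeasure lborel K"
    using assms by (intro nn_integral_cmult_indicator) (simp add: compact_imp_closed)
  also have "\<dots> < \<infinity>" using emeasure_compact_finite[OF assms(1)] by (simp add: ennreal_mult_less_top)
  finally show ?thesis .
qed

lemma cball_subset_of_edist_frontier:
  fixes x0 :: "'a::euclidean_space"
  assumes "x0 \<in> \<Omega>" "ereal r < edist_to x0 (frontier \<Omega>)"
  shows "cball x0 r \<subseteq> \<Omega>"
proof (rule ccontr)
  assume "\<not> cball x0 r \<subseteq> \<Omega>"
  then obtain z where z: "z \<in> cball x0 r" "z \<notin> \<Omega>" by blast
  have r: "0 \<le> r" using z by (simp add: order_trans[OF zero_le_dist])
  have "cball x0 r \<inter> frontier \<Omega> \<noteq> {}"
  proof (rule connected_Int_frontier)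
    show "connected (cball x0 r)" by simp
    have "x0 \<in> cball x0 r \<inter> \<Omega>" using assms r by simp
    thus "cball x0 r \<inter> \<Omega> \<noteq> {}" by blast
    show "cball x0 r - \<Omega> \<noteq> {}" using z by auto
  qed
  then obtain y where y: "y \<in> frontier \<Omega>" "dist x0 y \<le> r" by auto
  have "edist_to x0 (frontier \<Omega>) \<le> ereal (dist x0 y)"
    unfolding edist_to_def using y by (intro INF_lower)
  also have "\<dots> \<le> ereal r" using y by simp
  finally show False using assms by simp
qed

theorem theorem7:
  fixes \<Omega> :: "(real^'n::finite) set" and x0 :: "real^'n"
    and r1 r2 T \<epsilon> :: real
  assumes "open \<Omega>" and "x0 \<in> \<Omega>"
    and "0 < r1" and "r1 < r2" and "ereal r2 < edist_to x0 (frontier \<Omega>)"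
    and "0 < T" and "0 < \<epsilon>" and "\<epsilon> < T"
  shows "\<exists>C \<kappa> :: real. 0 < C \<and> 0 < \<kappa> \<and> \<kappa> < 1 \<and>
    (\<forall>u :: real \<times> (real^'n) \<Rightarrow> real. C2_on (UNIV \<times> \<Omega>) u \<longrightarrow>
       L2H1_norm \<epsilon> (T - \<epsilon>) (ball_in \<Omega> x0 r2) u
       \<le> ennreal C
          * ennpowr (L2H1_norm 0 T (ball_in \<Omega> x0 r1) u
                     + L2_norm ({0<..<T} \<times> \<Omega>) (heat_op u)) \<kappa>
          * ennpowr (L2H1_norm 0 T \<Omega> u) (1 - \<kappa>))"
proof (cases "2 * \<epsilon> < T")
  case False
  hence "{\<epsilon><..<T - \<epsilon>} = {}" by auto
  hence "L2H1_norm \<epsilon> (T - \<epsilon>) S u = 0" for S and u :: "real \<times> (real^'n) \<Rightarrow> real"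
    unfolding L2H1_norm_def by (simp add: ennpowr_def)
  thus ?thesis by (intro exI[of _ "1/2"]) simp
next
  case \<epsilon>: True
  obtain r3 where r3: "r2 < r3" "ereal r3 < edist_to x0 (frontier \<Omega>)"
    using ereal_dense2[OF assms(5)] by auto
  have cb: "cball x0 r3 \<subseteq> \<Omega>" by (rule cball_subset_of_edist_frontier[OF assms(2) r3(2)])
  have bi: "ball_in \<Omega> x0 r = ball x0 r" if "r \<le> r3" for r
    using that cb by (auto simp: ball_in_def dist_commute)
  obtain C p q \<tau>0 where C: "0 < C" "0 < p" "0 < q" and
    three: "\<And>u V W \<tau>. C2jet (UNIV \<times> \<Omega>) u V W \<Longrightarrow> \<tau>0 \<le> \<tau> \<Longrightarrow>
      (\<integral>\<^sup>+z\<in>{\<epsilon><..<T - \<epsilon>} \<times> ball x0 r2. ennreal ((u z)\<^sup>2 + (\<Sum>i\<in>UNIV. (V (ex i) z)\<^sup>2)) \<partial>lborel)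
      \<le> ennreal C * (ennreal (exp (p * \<tau>)) *
           ((\<integral>\<^sup>+z\<in>{0<..<T} \<times> ball x0 r1. ennreal ((u z)\<^sup>2 + (\<Sum>i\<in>UNIV. (V (ex i) z)\<^sup>2)) \<partial>lborel)
           + (\<integral>\<^sup>+z\<in>{0<..<T} \<times> ball x0 r3. ennreal ((V et z - (\<Sum>i\<in>UNIV. W (ex i) (ex i) z))\<^sup>2) \<partial>lborel))
         + ennreal (exp (- q * \<tau>)) *
           (\<integral>\<^sup>+z\<in>{0<..<T} \<times> ball x0 r3. ennreal ((u z)\<^sup>2 + (\<Sum>i\<in>UNIV. (V (ex i) z)\<^sup>2)) \<partial>lborel))"
    by (rule three_cylinders_exponential[OF assms(3,4) r3(1) assms(7) \<epsilon> assms(1) cb]) (rule that; blast)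
  define \<kappa> where "\<kappa> = q / (p + q)"
  have \<kappa>: "0 < \<kappa>" "\<kappa> < 1" using C by (auto simp: \<kappa>_def)
  define C' where "C' = 2 * C + exp (q * \<tau>0)"
  have C': "0 < C'" using C by (simp add: C'_def add_pos_pos)
  show ?thesis
  proof (rule exI[of _ "sqrt C'"], rule exI[of _ \<kappa>], intro conjI allI impI)
    fix u :: "real \<times> (real^'n) \<Rightarrow> real"
    assume "C2_on (UNIV \<times> \<Omega>) u"
    then obtain V W where u: "C2jet (UNIV \<times> \<Omega>) u V W" by (rule C2_on_imp_C2jet)
    define U where "U z = (u z)\<^sup>2 + (\<Sum>i\<in>UNIV. (V (ex i) z)\<^sup>2)" for z
    define H where "H z = (V et z - (\<Sum>i\<in>UNIV. W (ex i) (ex i) z))\<^sup>2" for z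
    define I where "I s t r = (\<integral>\<^sup>+z\<in>{s<..<t} \<times> ball x0 r. ennreal (U z) \<partial>lborel)" for s t r
    define J where "J = (\<integral>\<^sup>+z\<in>{0<..<T} \<times> ball x0 r3. ennreal (H z) \<partial>lborel)"
    have sub: "{0..T} \<times> cball x0 r3 \<subseteq> UNIV \<times> \<Omega>" using cb by auto
    have cU: "continuous_on ({0..T} \<times> cball x0 r3) U" and cH: "continuous_on ({0..T} \<times> cball x0 r3) H"
      unfolding U_def H_def
      by (intro continuous_intros continuous_on_subset[OF C2jetD(3)[OF u] sub]
        continuous_on_subset[OF C2jetD(4)[OF u] sub] continuous_on_subset[OF C2jetD(5)[OF u] sub])+
    have fin: "I s t r < \<infinity>" if "0 \<le> s" "t \<le> T" "r \<le> r3" for s t r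
      unfolding I_def by (rule nn_set_integral_finite[OF _ _ cU]) (use that in \<open>auto intro: compact_Times\<close>)
    have finJ: "J < \<infinity>"
      unfolding J_def by (rule nn_set_integral_finite[OF _ _ cH]) (auto intro: compact_Times)
    define a where "a = enn2real (I \<epsilon> (T - \<epsilon>) r2)"
    define x where "x = enn2real (I 0 T r1)"
    define j where "j = enn2real J"
    define y where "y = enn2real (I 0 T r3)"
    have nn: "0 \<le> a" "0 \<le> x" "0 \<le> j" "0 \<le> y" by (simp_all add: a_def x_def j_def y_def)
    have e: "I \<epsilon> (T - \<epsilon>) r2 = ennreal a" "I 0 T r1 = ennreal x" "J = ennreal j" "I 0 T r3 = ennreal y"
      unfolding a_def x_def j_def y_def using fin finJ assms r3 by (simp_all add: less_imp_le)
    have "a \<le> C * (exp (p * \<tau>) * (x + j) + exp (- q * \<tau>) * y)" if "\<tau>0 \<le> \<tau>" for \<tau>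
    proof -
      have "ennreal a \<le> ennreal C * (ennreal (exp (p * \<tau>)) * (ennreal x + ennreal j) + ennreal (exp (- q * \<tau>)) * ennreal y)"
        using three[OF u that] e unfolding I_def J_def U_def H_def by simp
      also have "\<dots> = ennreal (C * (exp (p * \<tau>) * (x + j) + exp (- q * \<tau>) * y))"
        using nn C by (simp add: ennreal_mult ennreal_plus)
      finally show ?thesis using nn C by (subst (asm) ennreal_le_iff) auto
    qed
    moreover have "a \<le> y"
    proof -
      have "I \<epsilon> (T - \<epsilon>) r2 \<le> I 0 T r3"
        unfolding I_def using assms r3 by (intro nn_integral_mono) (auto simp: indicator_def)
      thus ?thesis unfolding e using nn by simp
    qed
    ultimately have "a \<le> C' * ((x + j) powr \<kappa> * y powr (1 - \<kappa>))"
      unfolding C'_def \<kappa>_def using nn C by (intro interpolation_optimisation) auto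
    hence "sqrt a \<le> sqrt (C' * ((x + j) powr \<kappa> * y powr (1 - \<kappa>)))" by simp
    also have "\<dots> = sqrt C' * (sqrt (x + j) powr \<kappa> * sqrt y powr (1 - \<kappa>))"
      using nn by (simp add: real_sqrt_mult powr_half_sqrt[symmetric] powr_powr mult.commute)
    also have "\<dots> \<le> sqrt C' * ((sqrt x + sqrt j) powr \<kappa> * sqrt y powr (1 - \<kappa>))"
      using nn \<kappa> C' sqrt_add_le_add_sqrt[of x j]
      by (intro mult_left_mono mult_right_mono powr_mono2) auto
    finally have main: "sqrt a \<le> sqrt C' * ((sqrt x + sqrt j) powr \<kappa> * sqrt y powr (1 - \<kappa>))" .
    have L: "L2H1_norm s t (ball x0 r) u = ennpowr (I s t r) (1/2)" if "r \<le> r3" for s t r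
    proof -
      have "ball x0 r \<subseteq> \<Omega>" using that cb by auto
      thus ?thesis unfolding I_def U_def using L2H1_norm_eq[OF u assms(1)] by simp
    qed
    have L1: "L2H1_norm 0 T (ball x0 r1) u = ennreal (sqrt x)"
      using assms r3 nn by (simp add: L e ennpowr_ennreal powr_half_sqrt)
    have L2: "L2H1_norm \<epsilon> (T - \<epsilon>) (ball x0 r2) u = ennreal (sqrt a)"
      using assms r3 nn by (simp add: L e ennpowr_ennreal powr_half_sqrt)
    have L3: "ennreal (sqrt y) \<le> L2H1_norm 0 T \<Omega> u"
    proof -
      have "ennreal (sqrt y) = L2H1_norm 0 T (ball x0 r3) u"
        using nn by (simp add: L e ennpowr_ennreal powr_half_sqrt)
      also have "\<dots> \<le> L2H1_norm 0 T \<Omega> u" using cb by (intro L2H1_norm_mono) auto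
      finally show ?thesis .
    qed
    have LJ: "ennreal (sqrt j) \<le> L2_norm ({0<..<T} \<times> \<Omega>) (heat_op u)"
    proof -
      have "(norm (heat_op u z))\<^sup>2 = H z" if "z \<in> {0<..<T} \<times> ball x0 r3" for z
      proof -
        have z: "snd z \<in> \<Omega>" using that cb by auto
        show ?thesis
          using C2jet_slice(2,3)[OF u assms(1) z] by (simp add: heat_op_def laplacian_def H_def)
      qed
      hence "(\<integral>\<^sup>+z\<in>{0<..<T} \<times> ball x0 r3. ennreal ((norm (heat_op u z))\<^sup>2) \<partial>lborel) = J"
        unfolding J_def by (intro nn_integral_cong) (auto simp: indicator_def)
      hence "ennreal (sqrt j) = L2_norm ({0<..<T} \<times> ball x0 r3) (heat_op u)"
        using nn by (simp add: L2_norm_def e ennpowr_ennreal powr_half_sqrt)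
      also have "\<dots> \<le> L2_norm ({0<..<T} \<times> \<Omega>) (heat_op u)" using cb by (intro L2_norm_mono) auto
      finally show ?thesis .
    qed
    have "L2H1_norm \<epsilon> (T - \<epsilon>) (ball_in \<Omega> x0 r2) u = ennreal (sqrt a)"
      using bi[of r2] r3 L2 by simp
    also have "\<dots> \<le> ennreal (sqrt C' * ((sqrt x + sqrt j) powr \<kappa> * sqrt y powr (1 - \<kappa>)))"
      using main by (rule ennreal_leI)
    also have "\<dots> = ennreal (sqrt C') * ennpowr (ennreal (sqrt x) + ennreal (sqrt j)) \<kappa> * ennpowr (ennreal (sqrt y)) (1 - \<kappa>)"
    proof -
      have "ennreal (sqrt x) + ennreal (sqrt j) = ennreal (sqrt x + sqrt j)" using nn by simp
      thus ?thesis using nn C' by (simp only: ennpowr_ennreal ennreal_mult mult.assoc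
        add_nonneg_nonneg real_sqrt_ge_zero powr_ge_zero mult_nonneg_nonneg less_imp_le)
    qed
    also have "\<dots> \<le> ennreal (sqrt C')
          * ennpowr (L2H1_norm 0 T (ball_in \<Omega> x0 r1) u + L2_norm ({0<..<T} \<times> \<Omega>) (heat_op u)) \<kappa>
          * ennpowr (L2H1_norm 0 T \<Omega> u) (1 - \<kappa>)"
      using \<kappa> bi[of r1] assms r3 L1 L3 LJ
      by (intro mult_mono ennpowr_mono add_mono) auto
    finally show "L2H1_norm \<epsilon> (T - \<epsilon>) (ball_in \<Omega> x0 r2) u \<le> ennreal (sqrt C')
          * ennpowr (L2H1_norm 0 T (ball_in \<Omega> x0 r1) u + L2_norm ({0<..<T} \<times> \<Omega>) (heat_op u)) \<kappa>
          * ennpowr (L2H1_norm 0 T \<Omega> u) (1 - \<kappa>)" .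
  qed (use C' \<kappa> in auto)
qed

end
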